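(* Let $d,m\ge 1$ be integers and $n=d+m$. Let $\mathcal{U}\subset\mathbb{R}^d$ be an open set, let $f=(f_1,\dots,f_m):\mathcal{U}\to\mathbb{R}^m$ be twice continuously differentiable, and let $\mathcal{M}=\{(x,f(x)):x\in\mathcal{U}\}\subset\mathbb{R}^n$. Suppose $\tau=(\tau_1,\dots,\tau_n)\in\mathbb{R}_{>0}^n$ satisfies \[\tau_1\ge\tau_2\ge\dots\ge\tau_d\ge\max_{d+1\le i\le n}\tau_i\quad\text{and}\quad \sum_{j=1}^m\tau_{d+j}<1.\] Then \[\dim_H\big(W_n(\tau)\cap\mathcal{M}\big)\ \ge\ \min_{1\le i\le d}\left\{\frac{n+1+\sum_{k=i}^{n}(\tau_i-\tau_k)}{\tau_i+1}-m\right\},\] where $\dim_H$ denotes Hausdorff dimension.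
   Context: For $\tau=(\tau_1,\dots,\tau_n)\in\mathbb{R}_{>0}^n$, the set of weighted simultaneously $\tau$-approximable points is \[W_n(\tau)=\left\{\mathbf{x}\in\mathbb{R}^n:\ |qx_i-p_i|<q^{-\tau_i}\ \text{for } 1\le i\le n,\ \text{for infinitely many } (\mathbf{p},q)\in\mathbb{Z}^n\times\mathbb{N}\right\}.\]
   Formalization: The formal theorem also assumes that U is nonempty and that τ_1+…+τ_n ≥ 1; without these the claim is false, since for U empty the right side is positive, and for sum below 1 the right side exceeds d = dim M (e.g. d=m=1, τ=(1/4,1/4) gives 7/5 > 1). *)

theory Defs
  imports "HOL-Analysis.Analysis"
begin

section \<open>Hausdorff measure and dimension\<close>

text \<open>
  The size of a covering set is \<open>(diam C)\<^sup>s\<close>. Since \<open>0 powr 0 = 0\<close> in HOL, the case \<open>s = 0\<close>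
  is separated so that the \<open>0\<close>-dimensional measure is the counting measure. Covering sets are
  required to be bounded because \<^const>\<open>diameter\<close> is real-valued and carries no information on
  unbounded sets. Countable families are sequences, which may contain the empty set.
\<close>

definition hausdorff_size :: "real \<Rightarrow> 'a::metric_space set \<Rightarrow> ennreal" where
  "hausdorff_size s C =
     (if C = {} then 0 else if s = 0 then 1 else ennreal (diameter C powr s))"

definition hausdorff_premeasure :: "real \<Rightarrow> real \<Rightarrow> 'a::metric_space set \<Rightarrow> ennreal" where
  "hausdorff_premeasure s \<delta> A =
     (INF C \<in> {C :: nat \<Rightarrow> 'a set. A \<subseteq> (\<Union>i. C i) \<and> (\<forall>i. bounded (C i) \<and> diameter (C i) \<le> \<delta>)}.
        \<Sum>i. hausdorff_size s (C i))"

definition hausdorff_measure :: "real \<Rightarrow> 'a::metric_space set \<Rightarrow> ennreal" where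
  "hausdorff_measure s A = (SUP \<delta> \<in> {0<..}. hausdorff_premeasure s \<delta> A)"

definition hausdorff_dim :: "'a::metric_space set \<Rightarrow> ereal" where
  "hausdorff_dim A = Inf {ereal s | s. 0 \<le> s \<and> hausdorff_measure s A = 0}"


section \<open>Twice continuously differentiable maps on an open set\<close>

text \<open>Derivatives are two-sided (\<open>at x\<close>), so this is meant for open \<open>U\<close> only.\<close>

definition C2_on :: "'a::real_normed_vector set \<Rightarrow> ('a \<Rightarrow> 'b::real_normed_vector) \<Rightarrow> bool" where
  "C2_on U f \<longleftrightarrow>
     (\<exists>(f' :: 'a \<Rightarrow> 'a \<Rightarrow>\<^sub>L 'b) (f'' :: 'a \<Rightarrow> 'a \<Rightarrow>\<^sub>L 'a \<Rightarrow>\<^sub>L 'b).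
        (\<forall>x\<in>U. (f has_derivative blinfun_apply (f' x)) (at x)) \<and>
        (\<forall>x\<in>U. (f' has_derivative blinfun_apply (f'' x)) (at x)) \<and>
        continuous_on U f'')"


section \<open>Weighted simultaneously approximable points on a graph\<close>

definition weighted_approximable :: "real ^ 'n \<Rightarrow> (real ^ 'n) set" where
  "weighted_approximable \<tau> =
     {x. infinite {(p :: int ^ 'n, q :: nat). 0 < q \<and>
           (\<forall>i. \<bar>real q * x $ i - real_of_int (p $ i)\<bar> < real q powr (- (\<tau> $ i)))}}"

text \<open>
  With \<open>d = CARD('d)\<close> and \<open>m = CARD('m)\<close>, Euclidean \<open>n\<close>-space for \<open>n = d + m\<close> is
  \<open>real ^ ('d + 'm)\<close>. The first \<open>d\<close> coordinates are indexed by \<open>Inl i\<close>, in the order of \<open>'d\<close>,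
  and the last \<open>m\<close> coordinates by \<open>Inr j\<close>.
\<close>

definition vec_append :: "real ^ 'd \<Rightarrow> real ^ 'm \<Rightarrow> real ^ ('d + 'm)" where
  "vec_append x y = (\<chi> k. case k of Inl i \<Rightarrow> x $ i | Inr j \<Rightarrow> y $ j)"

definition graph_on :: "(real ^ 'd) set \<Rightarrow> (real ^ 'd \<Rightarrow> real ^ 'm) \<Rightarrow> (real ^ ('d + 'm)) set" where
  "graph_on U f = (\<lambda>x. vec_append x (f x)) ` U"

text \<open>
  The indices \<open>k\<close> with \<open>i \<le> k \<le> n\<close>, where \<open>i\<close> is one of the first \<open>d\<close> indices.
\<close>

definition indices_from :: "'d::linorder \<Rightarrow> ('d + 'm) set" where
  "indices_from i = Inl ` {i..} \<union> range Inr"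

end

theory Submission
  imports Defs
begin

text \<open>
  Write \<open>\<sigma>\<close> for the sum of the last \<open>m\<close> exponents and project \<open>W\<^sub>n(\<tau>) \<inter> M\<close> to \<open>U\<close>, which is
  1-Lipschitz. Choose weights \<open>v\<^sub>i \<le> \<tau>\<^sub>i\<close> with total slightly below \<open>1 - \<sigma>\<close>. Dirichlet's theorem,
  applied to \<open>x\<close> together with the linearisation of \<open>f\<close> at \<open>x\<close>, shows that almost every \<open>x\<close> lies
  in infinitely many boxes with centre \<open>p/q\<close> and sides \<open>q powr (-1 - v\<^sub>i)\<close>, where by Taylor
  expansion \<open>f(p/q)\<close> is close to a rational point with denominator \<open>q\<close>; all points of the concentric
  box with the shorter sides \<open>q powr (-1 - \<tau>\<^sub>i - \<eta>)\<close> are then approximable with denominator \<open>q\<close>.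

  The passage from the long to the short boxes is a mass transference argument. Packing disjoint long
  boxes into an open set and moving the mass of each into its short box gives a density whose mass on
  a cube of side \<open>r\<close> is at most a constant times the \<open>s\<close>-th power of \<open>r\<close>: a long box that meets the
  cube fills a definite part of it, so disjointness bounds the total, whatever denominators occur.
  Iterating inside the short boxes gives a Cantor set that carries enough mass for every exponent
  below \<open>s\<close>.
\<close>

section \<open>Positive Hausdorff measure from nested levels\<close>

text \<open>A cover of \<open>A\<close> is mapped to a cover of the image by sets of no larger
  diameter. This carries the lower bound from the projection of the approximable points back to the
  graph.\<close>

lemma hausdorff_measure_image_le:
  fixes g :: "'a::metric_space \<Rightarrow> 'b::metric_space"
  assumes g: "\<And>x y. dist (g x) (g y) \<le> dist x y" and s: "0 \<le> s"
  shows "hausdorff_measure s (g ` A) \<le> hausdorff_measure s A"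
proof -
  have size: "hausdorff_size s (g ` C) \<le> hausdorff_size s C"
    and bdd: "bounded (g ` C)" and diam: "diameter (g ` C) \<le> diameter C" if "bounded C" for C
  proof -
    show "bounded (g ` C)"
    proof -
      obtain x e where "\<forall>y\<in>C. dist x y \<le> e" using \<open>bounded C\<close> by (auto simp: bounded_def)
      then have "\<forall>y\<in>g ` C. dist (g x) y \<le> e" using g[of x] order_trans by blast
      then show ?thesis unfolding bounded_def by blast
    qed
    show le: "diameter (g ` C) \<le> diameter C"
    proof (cases "C = {}")
      case False
      have "dist (g x) (g y) \<le> diameter C" if "x \<in> C" "y \<in> C" for x y
        using g[of x y] diameter_bounded_bound[OF \<open>bounded C\<close> that] by linarith
      then show ?thesis
        using False unfolding diameter_def[of "g ` C"] by (auto intro!: cSUP_least)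
    qed simp
    have "0 \<le> diameter (g ` C)"
      by (rule diameter_ge_0) fact
    then show "hausdorff_size s (g ` C) \<le> hausdorff_size s C"
      using le s by (auto simp: hausdorff_size_def intro!: ennreal_leI powr_mono2)
  qed
  have "hausdorff_premeasure s \<delta> (g ` A) \<le> hausdorff_premeasure s \<delta> A" for \<delta>
    unfolding hausdorff_premeasure_def
  proof (rule INF_mono)
    fix C :: "nat \<Rightarrow> 'a set"
    assume C: "C \<in> {C. A \<subseteq> (\<Union>i. C i) \<and> (\<forall>i. bounded (C i) \<and> diameter (C i) \<le> \<delta>)}"
    show "\<exists>D\<in>{D. g ` A \<subseteq> (\<Union>i. D i) \<and> (\<forall>i. bounded (D i) \<and> diameter (D i) \<le> \<delta>)}.
      (\<Sum>i. hausdorff_size s (D i)) \<le> (\<Sum>i. hausdorff_size s (C i))"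
    proof (intro bexI[of _ "\<lambda>i. g ` C i"] CollectI conjI allI)
      show "(\<Sum>i. hausdorff_size s (g ` C i)) \<le> (\<Sum>i. hausdorff_size s (C i))"
        using C by (intro suminf_le size) auto
      show "g ` A \<subseteq> (\<Union>i. g ` C i)" using C by blast
      show "bounded (g ` C i)" for i using C bdd by auto
      show "diameter (g ` C i) \<le> \<delta>" for i using C diam[of "C i"] by (auto intro: order_trans)
    qed
  qed
  then show ?thesis
    unfolding hausdorff_measure_def by (intro SUP_mono) auto
qed

text \<open>Right continuity of \<open>r powr s\<close> at the diameter \<open>D\<close>: it lets a
  covering set be enlarged to an open set of diameter at most some \<open>r > 0\<close> at a
  prescribed cost \<open>e\<close>, even if \<open>D = 0\<close>. For \<open>s = 0\<close> the size
  is 1 at every scale, so \<open>r = \<delta>\<close> serves.\<close>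

lemma powr_right_bound:
  fixes D s e \<delta> :: real
  assumes "0 \<le> D" "D < \<delta>" "0 < e" "0 \<le> s"
  shows "\<exists>r. D < r \<and> r \<le> \<delta> \<and> r powr s \<le> (if s = 0 then 1 else D powr s) + e"
proof (cases "s = 0")
  case True
  with assms show ?thesis by (intro exI[of _ \<delta>]) auto
next
  case False
  have "((\<lambda>r. r powr s) \<longlongrightarrow> D powr s) (at_right D)"
  proof (rule tendsto_powr2)
    show "\<forall>\<^sub>F x in at_right D. 0 \<le> x"
      using assms by (auto simp: eventually_at_right_field intro!: exI[of _ "D+1"])
  qed (use False assms in auto)
  then have "\<forall>\<^sub>F r in at_right D. r powr s < D powr s + e"
    using assms by (auto intro: order_tendstoD)
  moreover have "\<forall>\<^sub>F r in at_right D. D < r \<and> r \<le> \<delta>"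
    using assms by (auto simp: eventually_at_right_field intro!: exI[of _ \<delta>])
  ultimately have "\<forall>\<^sub>F r in at_right D. D < r \<and> r \<le> \<delta> \<and> r powr s < D powr s + e"
    by eventually_elim auto
  then obtain r where "D < r \<and> r \<le> \<delta> \<and> r powr s < D powr s + e"
    using eventually_happens'[OF trivial_limit_at_right_real] by blast
  then show ?thesis using False by (intro exI[of _ r]) auto
qed

lemma sum_UN_le:
  fixes g :: "'a \<Rightarrow> real"
  assumes "finite I" "\<And>i. i \<in> I \<Longrightarrow> finite (A i)" "\<And>i x. i \<in> I \<Longrightarrow> x \<in> A i \<Longrightarrow> 0 \<le> g x"
  shows "sum g (\<Union>i\<in>I. A i) \<le> (\<Sum>i\<in>I. sum g (A i))"
  using assms
proof (induction I rule: finite_induct)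
  case (insert i I)
  have "sum g (A i \<union> (\<Union>i\<in>I. A i)) \<le> sum g (A i) + sum g (\<Union>i\<in>I. A i)"
    using insert by (subst sum_Un) (auto intro!: sum_nonneg)
  moreover have "sum g (\<Union>i\<in>I. A i) \<le> (\<Sum>i\<in>I. sum g (A i))"
    using insert by auto
  ultimately show ?case using insert by simp
qed simp

text \<open>
  No limit measure is needed: by compactness a cover of the limit set already covers
  some finite level, where the mass is a finite sum.
\<close>

lemma hausdorff_measure_pos_of_levels:
  fixes S :: "nat \<Rightarrow> 'i set" and R :: "'i \<Rightarrow> 'a::heine_borel set" and m :: "nat \<Rightarrow> 'i \<Rightarrow> real"
  defines "hit \<equiv> \<lambda>j C. \<Sum>i\<in>{i\<in>S j. R i \<inter> C \<noteq> {}}. m j i"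
  assumes fin: "\<And>j. finite (S j)"
    and comp: "\<And>j i. i \<in> S j \<Longrightarrow> compact (R i)"
    and nonempty: "\<And>j i. i \<in> S j \<Longrightarrow> R i \<noteq> {}"
    and m0: "\<And>j i. i \<in> S j \<Longrightarrow> 0 \<le> m j i"
    and m1: "\<And>j. (\<Sum>i\<in>S j. m j i) = 1"
    and nest: "\<And>j. (\<Union>i\<in>S (Suc j). R i) \<subseteq> (\<Union>i\<in>S j. R i)"
    and mono: "\<And>j C. hit (Suc j) C \<le> hit j C"
    and bound: "\<And>C r. 0 < r \<Longrightarrow> r \<le> \<delta> \<Longrightarrow> (\<And>x y. x \<in> C \<Longrightarrow> y \<in> C \<Longrightarrow> dist x y \<le> r) \<Longrightarrow>
                  \<exists>j. hit j C \<le> K * r powr s"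
    and sub: "(\<Inter>j. \<Union>i\<in>S j. R i) \<subseteq> A"
    and pos: "0 \<le> s" "0 < \<delta>" "0 < K"
  shows "hausdorff_measure s A \<noteq> 0"
proof
  assume "hausdorff_measure s A = 0"
  then have "hausdorff_premeasure s (\<delta>/2) A \<le> 0"
    using pos SUP_upper[of "\<delta>/2" "{0<..}" "\<lambda>\<delta>. hausdorff_premeasure s \<delta> A"]
    by (simp add: hausdorff_measure_def)
  \<comment> \<open>The cover costs less than \<open>e\<close> and its enlargement to open sets at
    most \<open>e\<close> more, so \<open>K\<close> times the total stays below 1, the mass of every
    level.\<close>
  define e where "e = 1 / (2 * K)"
  have e: "0 < e" using pos by (simp add: e_def)
  have "hausdorff_premeasure s (\<delta>/2) A < ennreal e"
    using \<open>hausdorff_premeasure s (\<delta>/2) A \<le> 0\<close> e by (simp add: ennreal_less_zero_iff)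
  then obtain C where cover: "A \<subseteq> (\<Union>i. C i)" and bdd: "\<And>i. bounded (C i)"
    and diam: "\<And>i. diameter (C i) \<le> \<delta>/2" and small: "(\<Sum>i. hausdorff_size s (C i)) < ennreal e"
    unfolding hausdorff_premeasure_def INF_less_iff by blast
  define u where "u i = (if C i = {} then 0 else if s = 0 then 1 else diameter (C i) powr s)" for i
  have size: "hausdorff_size s (C i) = ennreal (u i)" for i
    by (simp add: hausdorff_size_def u_def)
  have u0: "0 \<le> u i" for i by (simp add: u_def)
  have diam0: "0 \<le> diameter (C i)" for i using bdd diameter_ge_0 by auto
  have "\<exists>r V. 0 < r \<and> r \<le> \<delta> \<and> r powr s \<le> u i + e * (1/2) ^ Suc i \<and> open V \<and> C i \<subseteq> V
          \<and> (\<forall>x\<in>V. \<forall>y\<in>V. dist x y \<le> r)" if "C i \<noteq> {}" for i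
  proof -
    have "0 < e * (1/2) ^ Suc i" using e by simp
    then obtain r where r: "diameter (C i) < r" "r \<le> \<delta>"
        "r powr s \<le> (if s = 0 then 1 else diameter (C i) powr s) + e * (1/2) ^ Suc i"
      using powr_right_bound[of "diameter (C i)" \<delta> "e * (1/2) ^ Suc i" s] diam0[of i] diam[of i] pos
      by auto
    \<comment> \<open>Half of the slack, because each of the two points compared may lie up to
      \<open>h\<close> away from \<open>C i\<close>.\<close>
    define h where "h = (r - diameter (C i)) / 2"
    define V where "V = (\<Union>x\<in>C i. ball x h)"
    have "0 < h" using r by (simp add: h_def)
    have "dist x y \<le> r" if xy: "x \<in> V" "y \<in> V" for x y
    proof -
      obtain x' y' where "x' \<in> C i" "y' \<in> C i" "dist x' x < h" "dist y' y < h"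
        using xy unfolding V_def UN_iff mem_ball by metis
      moreover have "dist x' y' \<le> diameter (C i)"
        using diameter_bounded_bound[OF bdd] calculation by auto
      moreover have "dist x y \<le> dist x' x + dist x' y' + dist y' y"
        using dist_triangle[of x y x'] dist_triangle[of x' y y'] by (simp add: dist_commute)
      ultimately show ?thesis by (auto simp: h_def field_simps)
    qed
    moreover have "open V" "C i \<subseteq> V" using \<open>0 < h\<close> by (auto simp: V_def)
    moreover have "0 < r" using r diam0[of i] by linarith
    ultimately show ?thesis using r that unfolding u_def by (intro exI[of _ r] exI[of _ V]) auto
  qed
  then obtain r V where rV: "\<And>i. C i \<noteq> {} \<Longrightarrow> 0 < r i \<and> r i \<le> \<delta> \<and> r i powr s \<le> u i + e * (1/2) ^ Suc i
      \<and> open (V i) \<and> C i \<subseteq> V i \<and> (\<forall>x\<in>V i. \<forall>y\<in>V i. dist x y \<le> r i)" by metis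
  define N where "N = {i. C i \<noteq> {}}"
  have "\<exists>j. hit j (V i) \<le> K * r i powr s" if "i \<in> N" for i
    by (rule bound) (use rV that in \<open>auto simp: N_def\<close>)
  then obtain lev where lev: "\<And>i. i \<in> N \<Longrightarrow> hit (lev i) (V i) \<le> K * r i powr s" by metis
  define L where "L j = (\<Union>i\<in>S j. R i)" for j
  define W where "W = (\<Union>i\<in>N. V i)"
  have "open W" using rV by (auto simp: W_def N_def)
  have "A \<subseteq> W"
  proof
    fix x assume "x \<in> A"
    then obtain i where "x \<in> C i" using cover by auto
    then show "x \<in> W" using rV[of i] unfolding W_def N_def by blast
  qed
  have Lcomp: "compact (L j)" for j
    unfolding L_def using fin comp by (intro compact_UN) auto
  have Lanti: "L j \<subseteq> L i" if "i \<le> j" for i j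
    using lift_Suc_antimono_le[of L, OF _ that] nest by (auto simp: L_def)
  \<comment> \<open>Otherwise the sets \<open>L j - W\<close> are nested, compact and nonempty, and
    a common point would belong to the limit set but not to \<open>W\<close>.\<close>
  have "\<exists>J. L J \<subseteq> W"
  proof (rule ccontr)
    assume neg: "\<nexists>J. L J \<subseteq> W"
    have "\<Inter> (range (\<lambda>j. L j - W)) \<noteq> {}"
      by (rule compact_nest) (use neg Lanti Lcomp \<open>open W\<close> in \<open>auto intro: compact_diff\<close>)
    then show False using sub \<open>A \<subseteq> W\<close> by (auto simp: L_def)
  qed
  then obtain J where J: "L J \<subseteq> W" by blast
  obtain I where I: "I \<subseteq> N" "finite I" "L J \<subseteq> (\<Union>i\<in>I. V i)"
    using compactE_image[OF Lcomp[of J], of N V] J rV unfolding W_def N_def by auto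
  \<comment> \<open>Each mass bound was found at its own level; \<open>mono\<close> keeps all of
    them valid at the common level \<open>J'\<close>, which the chosen open sets still
    cover.\<close>
  define J' where "J' = Max (insert J (lev ` I))"
  have J': "J \<le> J'" "\<And>i. i \<in> I \<Longrightarrow> lev i \<le> J'"
    using I unfolding J'_def by auto
  have hit_anti: "hit j C \<le> hit i C" if "i \<le> j" for i j C
    using lift_Suc_antimono_le[of "\<lambda>j. hit j C", OF mono that] .
  have "1 = (\<Sum>k\<in>S J'. m J' k)" by (simp add: m1)
  also have "\<dots> \<le> (\<Sum>k\<in>(\<Union>i\<in>I. {k\<in>S J'. R k \<inter> V i \<noteq> {}}). m J' k)"
  proof (rule sum_mono2)
    show "S J' \<subseteq> (\<Union>i\<in>I. {k\<in>S J'. R k \<inter> V i \<noteq> {}})"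
    proof
      fix k assume k: "k \<in> S J'"
      obtain x where "x \<in> R k" using nonempty[OF k] by blast
      then have "x \<in> L J'" using k by (auto simp: L_def)
      then have "x \<in> (\<Union>i\<in>I. V i)" using Lanti[OF J'(1)] I by blast
      then show "k \<in> (\<Union>i\<in>I. {k\<in>S J'. R k \<inter> V i \<noteq> {}})" using k \<open>x \<in> R k\<close> by auto
    qed
  qed (use I fin m0 in auto)
  also have "\<dots> \<le> (\<Sum>i\<in>I. hit J' (V i))"
    unfolding hit_def using I fin m0 by (intro sum_UN_le) auto
  also have "\<dots> \<le> (\<Sum>i\<in>I. K * r i powr s)"
    using lev hit_anti J' I by (intro sum_mono) (meson order_trans subsetD)
  also have "\<dots> \<le> (\<Sum>i\<in>I. K * (u i + e * (1/2) ^ Suc i))"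
  proof (intro sum_mono mult_left_mono)
    fix i assume "i \<in> I"
    then have "C i \<noteq> {}" using I by (auto simp: N_def)
    then show "r i powr s \<le> u i + e * (1/2) ^ Suc i" using rV by blast
  qed (use pos in auto)
  also have "\<dots> = K * ((\<Sum>i\<in>I. u i) + e * (\<Sum>i\<in>I. (1/2) ^ Suc i))"
    by (simp only: sum_distrib_left sum.distrib distrib_left)
  also have "\<dots> < K * (e + e * 1)"
  proof (intro mult_strict_left_mono add_less_le_mono mult_left_mono)
    have "ennreal (\<Sum>i\<in>I. u i) = (\<Sum>i\<in>I. hausdorff_size s (C i))"
      using u0 by (simp add: size)
    also have "\<dots> \<le> (\<Sum>i. hausdorff_size s (C i))" by (rule sum_le_suminf) (use I in auto)
    finally have "ennreal (\<Sum>i\<in>I. u i) < ennreal e" using small by simp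
    then show "(\<Sum>i\<in>I. u i) < e"
      using e by (simp add: ennreal_less_iff sum_nonneg u0)
    show "(\<Sum>i\<in>I. (1/2) ^ Suc i) \<le> (1::real)"
      using sum_le_suminf[of "\<lambda>i. (1/2::real) ^ Suc i" I] power_half_series I
      by (simp add: sums_iff)
  qed (use e pos in auto)
  also have "\<dots> = 1" using pos by (simp add: e_def)
  finally show False by simp
qed

section \<open>Boxes with weighted sides\<close>

text \<open>\<open>c\<close> pairs a centre with a denominator \<open>q\<close>, and
  \<open>q powr - a i\<close> is half of the \<open>i\<close>-th side. For fixed exponents
  \<open>a i \<ge> 0\<close> the denominator alone determines the shape, so any two boxes are
  comparable in all coordinates at once.\<close>

definition scaled_box :: "('d::finite \<Rightarrow> real) \<Rightarrow> (real ^ 'd) \<times> real \<Rightarrow> (real ^ 'd) set" where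
  "scaled_box a c = box (\<chi> i. fst c $ i - snd c powr - a i) (\<chi> i. fst c $ i + snd c powr - a i)"

definition scaled_cbox :: "('d::finite \<Rightarrow> real) \<Rightarrow> (real ^ 'd) \<times> real \<Rightarrow> (real ^ 'd) set" where
  "scaled_cbox a c = cbox (\<chi> i. fst c $ i - snd c powr - a i) (\<chi> i. fst c $ i + snd c powr - a i)"

lemma mem_scaled_box: "x \<in> scaled_box a c \<longleftrightarrow> (\<forall>i. \<bar>x $ i - fst c $ i\<bar> < snd c powr - a i)"
  unfolding scaled_box_def mem_box_cart by (simp add: abs_less_iff) (smt (verit))

lemma mem_scaled_cbox: "x \<in> scaled_cbox a c \<longleftrightarrow> (\<forall>i. \<bar>x $ i - fst c $ i\<bar> \<le> snd c powr - a i)"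
  unfolding scaled_cbox_def mem_box_cart by (simp add: abs_le_iff) (smt (verit))

lemma open_scaled_box [simp]: "open (scaled_box a c)"
  and compact_scaled_cbox [simp]: "compact (scaled_cbox a c)"
  by (auto simp: scaled_box_def scaled_cbox_def open_box)

lemma measure_cbox_vec:
  fixes a b :: "real ^ 'd::finite"
  assumes "\<And>i. a $ i \<le> b $ i"
  shows "measure lborel (cbox a b) = (\<Prod>i\<in>UNIV. b $ i - a $ i)"
    and "measure lborel (box a b) = (\<Prod>i\<in>UNIV. b $ i - a $ i)"
proof -
  have "cbox a b \<noteq> {}" using assms by (simp add: interval_ne_empty_cart)
  then show *: "measure lborel (cbox a b) = (\<Prod>i\<in>UNIV. b $ i - a $ i)"
    by (rule content_cbox_cart)
  have "\<And>i. i \<in> Basis \<Longrightarrow> a \<bullet> i \<le> b \<bullet> i"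
    using assms by (auto simp: Basis_vec_def inner_axis)
  then show "measure lborel (box a b) = (\<Prod>i\<in>UNIV. b $ i - a $ i)"
    using * by (simp add: measure_lborel_box_eq measure_lborel_cbox_eq)
qed

lemma measure_scaled_box: "measure lborel (scaled_box a c) = 2 ^ CARD('d) * (\<Prod>i\<in>UNIV. snd c powr - a i)"
  and measure_scaled_cbox: "measure lborel (scaled_cbox a c) = 2 ^ CARD('d) * (\<Prod>i\<in>UNIV. snd c powr - a i)"
  for a :: "'d::finite \<Rightarrow> real"
  unfolding scaled_box_def scaled_cbox_def
  by (simp_all add: measure_cbox_vec flip: prod.distrib mult_2 prod_constant)

lemma scaled_cbox_subset_box:
  assumes "\<And>i. a i < b i" "1 < snd c"
  shows "scaled_cbox b c \<subseteq> scaled_box a c"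
proof
  fix x assume x: "x \<in> scaled_cbox b c"
  have "snd c powr - b i < snd c powr - a i" for i
    using assms by simp
  with x show "x \<in> scaled_box a c"
    unfolding mem_scaled_box mem_scaled_cbox by (meson le_less_trans)
qed

text \<open>Substituting \<open>r = q powr - t\<close> turns the product bound into an inequality between exponents.\<close>

lemma prod_bound_of_exponents:
  fixes a b :: "'d::finite \<Rightarrow> real"
  assumes ex: "\<And>t. 0 \<le> t \<Longrightarrow> s * t \<le> (\<Sum>i\<in>UNIV. min (a i) t + max 0 (t - b i))"
    and q: "1 < q" and r: "0 < r" "r \<le> 1"
  shows "(\<Prod>i\<in>UNIV. max 1 (q powr - a i / r) * min 1 (r * q powr b i)) \<le> r powr (s - real CARD('d))"
proof -
  define t where "t = - log q r"
  have t: "0 \<le> t" using q r by (simp add: t_def)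
  have rt: "r = q powr - t" using q r by (simp add: t_def)
  have "max 1 (q powr - a i / r) = q powr (t - min (a i) t)" for i
    using q unfolding rt by (auto simp: max_def min_def powr_diff powr_minus divide_simps)
  moreover have "min 1 (r * q powr b i) = q powr (- max 0 (t - b i))" for i
  proof (cases "b i \<le> t")
    case True
    then have "q powr (b i - t) \<le> q powr 0" using q by (intro powr_mono) auto
    then show ?thesis using True q unfolding rt by (simp add: powr_add[symmetric])
  next
    case False
    then have "q powr 0 \<le> q powr (b i - t)" using q by (intro powr_mono) auto
    then show ?thesis using False q unfolding rt by (simp add: powr_add[symmetric])
  qed
  ultimately have "(\<Prod>i\<in>UNIV. max 1 (q powr - a i / r) * min 1 (r * q powr b i)) =
      (\<Prod>i\<in>UNIV. q powr (t - (min (a i) t + max 0 (t - b i))))"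
    by (simp flip: powr_add add: algebra_simps)
  also have "\<dots> = q powr (\<Sum>i\<in>UNIV. t - (min (a i) t + max 0 (t - b i)))"
    using q by (simp add: powr_sum)
  also have "\<dots> = q powr (CARD('d) * t - (\<Sum>i\<in>UNIV. min (a i) t + max 0 (t - b i)))"
    by (simp add: sum_subtractf)
  also have "\<dots> \<le> q powr (CARD('d) * t - s * t)"
    using q ex[OF t] by (intro powr_mono) auto
  also have "\<dots> = r powr (s - CARD('d))"
    using q unfolding rt powr_powr by (simp add: algebra_simps)
  finally show ?thesis .
qed

text \<open>The left side is the mass of a cube of half-side \<open>r\<close> when the volume of
  each long box is spread evenly over its short box. If the short box meets the cube, the long box
  has at least the product of the \<open>min (\<alpha> i) r\<close> as volume in the doubled cube
  \<open>J\<close>, and \<open>prod_bound_of_exponents\<close> compares the contribution with that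
  volume. Disjointness bounds the sum by the volume of \<open>J\<close>.\<close>

lemma scaled_boxes_local_mass:
  fixes a b :: "'d::finite \<Rightarrow> real" and S :: "((real ^ 'd) \<times> real) set"
  assumes ex: "\<And>t. 0 \<le> t \<Longrightarrow> s * t \<le> (\<Sum>i\<in>UNIV. min (a i) t + max 0 (t - b i))"
    and ab: "\<And>i. a i < b i"
    and fin: "finite S" and q: "\<And>c. c \<in> S \<Longrightarrow> 1 < snd c"
    and disj: "disjoint_family_on (scaled_box a) S"
    and r: "0 < r" "r \<le> 1"
  shows "(\<Sum>c\<in>S. measure lborel (scaled_box a c) *
            measure lborel (scaled_cbox b c \<inter> cbox (\<chi> i. x $ i - r) (\<chi> i. x $ i + r))
              / measure lborel (scaled_cbox b c)) \<le> 8 ^ CARD('d) * r powr s"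
proof -
  define d where "d = CARD('d)"
  define I where "I = cbox (\<chi> i. x $ i - r) (\<chi> i. x $ i + r)"
  define J where "J = cbox (\<chi> i. x $ i - 2 * r) (\<chi> i. x $ i + 2 * r)"
  have *: "measure lborel (scaled_box a c) * measure lborel (scaled_cbox b c \<inter> I) / measure lborel (scaled_cbox b c)
      \<le> 2 ^ d * r powr (s - d) * measure lborel (scaled_box a c \<inter> J)" (is "?L \<le> _") if "c \<in> S" for c
  proof (cases "scaled_cbox b c \<inter> I = {}")
    case True then show ?thesis by simp
  next
    case False
    define \<alpha> \<beta> where "\<alpha> i = snd c powr - a i" and "\<beta> i = snd c powr - b i" for i
    have q1: "1 < snd c" using q that by auto
    have pos: "0 < \<alpha> i" "0 < \<beta> i" for i using q1 by (auto simp: \<alpha>_def \<beta>_def)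
    have less: "\<beta> i < \<alpha> i" for i using q1 ab by (auto simp: \<alpha>_def \<beta>_def)
    obtain u where u: "\<And>i. \<bar>u $ i - fst c $ i\<bar> \<le> \<beta> i" "\<And>i. \<bar>u $ i - x $ i\<bar> \<le> r"
      using False unfolding I_def mem_scaled_cbox \<beta>_def
      by (auto simp: mem_scaled_cbox mem_box_cart abs_le_iff algebra_simps) 
        (metis add.commute diff_le_eq le_diff_eq)
    define z where "z = fst c"
    have I_eq: "scaled_cbox b c \<inter> I = cbox (\<chi> i. max (z $ i - \<beta> i) (x $ i - r)) (\<chi> i. min (z $ i + \<beta> i) (x $ i + r))"
      by (auto simp: scaled_cbox_def I_def mem_box_cart \<beta>_def z_def)
    have le: "max (z $ i - \<beta> i) (x $ i - r) \<le> min (z $ i + \<beta> i) (x $ i + r)" for i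
      using u[of i] by (auto simp: z_def)
    have "measure lborel (scaled_cbox b c \<inter> I) \<le> (\<Prod>i\<in>UNIV. 2 * \<beta> i * min 1 (r / \<beta> i))"
      unfolding I_eq using le pos
      by (subst measure_cbox_vec) (auto intro!: prod_mono simp: min_def max_def field_simps)
    moreover have "measure lborel (scaled_cbox b c) = (\<Prod>i\<in>UNIV. 2 * \<beta> i)"
      by (simp add: measure_scaled_cbox \<beta>_def prod.distrib)
    moreover have "0 < (\<Prod>i\<in>UNIV. 2 * \<beta> i)" using pos by (intro prod_pos) auto
    ultimately have "measure lborel (scaled_cbox b c \<inter> I) / measure lborel (scaled_cbox b c) \<le> (\<Prod>i\<in>UNIV. min 1 (r / \<beta> i))"
      by (simp add: prod.distrib divide_le_eq mult.commute)
    then have "?L \<le> 2 ^ d * ((\<Prod>i\<in>UNIV. \<alpha> i) * (\<Prod>i\<in>UNIV. min 1 (r / \<beta> i)))"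
      unfolding measure_scaled_box \<alpha>_def[symmetric] d_def using pos
      by (simp add: mult.assoc mult_left_mono prod_nonneg less_imp_le flip: times_divide_eq_right)
    \<comment> \<open>Each \<open>\<alpha> i\<close> splits into
      \<open>max 1 (\<alpha> i / r)\<close> and \<open>min (\<alpha> i) r\<close>: the first factor
      enters the exponent inequality, the second is kept as volume inside \<open>J\<close>.\<close>
    also have "(\<Prod>i\<in>UNIV. \<alpha> i) * (\<Prod>i\<in>UNIV. min 1 (r / \<beta> i)) =
      (\<Prod>i\<in>UNIV. max 1 (snd c powr - a i / r) * min 1 (r * snd c powr b i)) * (\<Prod>i\<in>UNIV. min (\<alpha> i) r)"
    proof (unfold prod.distrib[symmetric], rule prod.cong)
      fix i
      have "r / \<beta> i = r * snd c powr b i" by (simp add: \<beta>_def powr_minus field_simps)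
      moreover have "\<alpha> i = max 1 (\<alpha> i / r) * min (\<alpha> i) r"
        using r pos[of i] by (auto simp: max_def min_def)
      ultimately show "\<alpha> i * min 1 (r / \<beta> i) = max 1 (snd c powr - a i / r) * min 1 (r * snd c powr b i) * min (\<alpha> i) r"
        by (simp add: \<alpha>_def)
    qed simp
    also have "\<dots> \<le> r powr (s - d) * (\<Prod>i\<in>UNIV. min (\<alpha> i) r)"
      unfolding d_def using pos r by (intro mult_right_mono prod_bound_of_exponents[OF ex q1 r] prod_nonneg) (auto simp: less_imp_le)
    also have "(\<Prod>i\<in>UNIV. min (\<alpha> i) r) \<le> measure lborel (scaled_box a c \<inter> J)"
    proof -
      have J_eq: "scaled_box a c \<inter> box (\<chi> i. x $ i - 2 * r) (\<chi> i. x $ i + 2 * r) =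
          box (\<chi> i. max (z $ i - \<alpha> i) (x $ i - 2 * r)) (\<chi> i. min (z $ i + \<alpha> i) (x $ i + 2 * r))"
        by (auto simp: scaled_box_def mem_box_cart \<alpha>_def z_def)
      \<comment> \<open>The point \<open>u\<close> of the short box lies within \<open>r\<close> of
        \<open>x\<close>, so the centres of the two intervals, of half-lengths
        \<open>\<alpha> i\<close> and \<open>2 * r\<close>, are less than
        \<open>\<alpha> i + r\<close> apart. This forces the overlap.\<close>
      have "min (\<alpha> i) r \<le> min (z $ i + \<alpha> i) (x $ i + 2 * r) - max (z $ i - \<alpha> i) (x $ i - 2 * r)" for i
        using u[of i] less[of i] pos[of i] r unfolding z_def by (auto simp: abs_le_iff)
      moreover have "max (z $ i - \<alpha> i) (x $ i - 2 * r) \<le> min (z $ i + \<alpha> i) (x $ i + 2 * r)" for i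
        using u[of i] less[of i] pos[of i] r unfolding z_def by (auto simp: abs_le_iff)
      ultimately have "(\<Prod>i\<in>UNIV. min (\<alpha> i) r) \<le> measure lborel (scaled_box a c \<inter> box (\<chi> i. x $ i - 2 * r) (\<chi> i. x $ i + 2 * r))"
        unfolding J_eq using pos r by (subst measure_cbox_vec) (auto intro!: prod_mono simp: less_imp_le)
      also have "\<dots> \<le> measure lborel (scaled_box a c \<inter> J)"
      proof (rule measure_mono_fmeasurable)
        show "scaled_box a c \<inter> J \<in> fmeasurable lborel"
          unfolding J_def scaled_box_def by (intro fmeasurable_Int_fmeasurable fmeasurable_box) auto
      qed (use box_subset_cbox in \<open>auto simp: J_def scaled_box_def\<close>)
      finally show ?thesis .
    qed
    finally show ?thesis by (simp add: mult_left_mono mult.assoc)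
  qed
  have meas: "scaled_box a c \<inter> J \<in> fmeasurable lborel" for c
    unfolding J_def scaled_box_def by (intro fmeasurable_Int_fmeasurable fmeasurable_box) auto
  have "(\<Sum>c\<in>S. measure lborel (scaled_box a c) * measure lborel (scaled_cbox b c \<inter> I) / measure lborel (scaled_cbox b c))
     \<le> (\<Sum>c\<in>S. 2 ^ d * r powr (s - d) * measure lborel (scaled_box a c \<inter> J))"
    by (intro sum_mono *)
  also have "\<dots> = 2 ^ d * r powr (s - d) * measure lborel (\<Union>c\<in>S. scaled_box a c \<inter> J)"
  proof (subst measure_finite_Union)
    show "disjoint_family_on (\<lambda>c. scaled_box a c \<inter> J) S"
      using disj unfolding disjoint_family_on_def by blast
    show "emeasure lborel (scaled_box a c \<inter> J) \<noteq> \<infinity>" for c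
      using meas[of c] by (simp add: fmeasurableD2)
  qed (use fin in \<open>auto simp: sum_distrib_left J_def scaled_box_def\<close>)
  also have "\<dots> \<le> 2 ^ d * r powr (s - d) * measure lborel J"
    using fin by (intro mult_left_mono measure_mono_fmeasurable sets.finite_UN)
      (auto simp: J_def scaled_box_def)
  also have "measure lborel J = 4 ^ d * r ^ d"
    unfolding J_def d_def using r by (subst measure_cbox_vec) (auto simp: power_mult_distrib)
  also have "2 ^ d * r powr (s - d) * (4 ^ d * r ^ d) = 8 ^ d * r powr s"
  proof -
    have "(8::real) ^ d = 2 ^ d * 4 ^ d" using power_mult_distrib[of "2::real" 4 d] by simp
    moreover have "r powr (s - d) * r ^ d = r powr s" using r by (simp add: powr_diff powr_realpow)
    ultimately show ?thesis by (simp add: mult_ac)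
  qed
  finally show ?thesis unfolding I_def d_def .
qed

section \<open>Covering and packing by weighted boxes\<close>

text \<open>Greedy choice of the smallest denominator, that is, of the box longest in every
  coordinate simultaneously. A box that meets it lies in its threefold enlargement; the boxes that
  miss it are left to the induction.\<close>

lemma scaled_boxes_vitali:
  fixes a :: "'d::finite \<Rightarrow> real"
  assumes "finite F" and "\<And>i. 0 \<le> a i" and "\<And>c. c \<in> F \<Longrightarrow> 0 < snd c"
  shows "\<exists>S\<subseteq>F. disjoint_family_on (scaled_box a) S \<and>
    (\<Union>c\<in>F. scaled_box a c) \<subseteq> (\<Union>c\<in>S. {x. \<forall>i. \<bar>x $ i - fst c $ i\<bar> < 3 * snd c powr - a i})"
  using assms(1,3)
proof (induction F rule: finite_psubset_induct)
  case (psubset F)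
  show ?case
  proof (cases "F = {}")
    case True then show ?thesis by (auto simp: disjoint_family_on_def)
  next
    case False
    then obtain c0 where c0: "c0 \<in> F" "\<And>c. c \<in> F \<Longrightarrow> snd c0 \<le> snd c"
      using psubset.hyps arg_min_if_finite[of F snd] by (metis linorder_not_less)
    define F' where "F' = {c\<in>F. scaled_box a c \<inter> scaled_box a c0 = {}}"
    have "fst c0 \<in> scaled_box a c0" using psubset.prems[OF c0(1)] by (simp add: mem_scaled_box)
    then have "F' \<subset> F" using c0 by (auto simp: F'_def)
    then obtain S where S: "S \<subseteq> F'" "disjoint_family_on (scaled_box a) S"
      "(\<Union>c\<in>F'. scaled_box a c) \<subseteq> (\<Union>c\<in>S. {x. \<forall>i. \<bar>x $ i - fst c $ i\<bar> < 3 * snd c powr - a i})"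
      using psubset.IH[OF \<open>F' \<subset> F\<close>] psubset.prems \<open>F' \<subset> F\<close> by blast
    have hit: "x \<in> {x. \<forall>i. \<bar>x $ i - fst c0 $ i\<bar> < 3 * snd c0 powr - a i}"
      if c: "c \<in> F" "c \<notin> F'" "x \<in> scaled_box a c" for c x
    proof -
      obtain y where y: "y \<in> scaled_box a c" "y \<in> scaled_box a c0" using c by (auto simp: F'_def)
      have "\<bar>x $ i - fst c0 $ i\<bar> < 3 * snd c0 powr - a i" for i
      proof -
        have "snd c powr - a i \<le> snd c0 powr - a i"
          using c0 c psubset.prems assms(2)[of i] by (intro powr_mono2') auto
        moreover have "\<bar>x $ i - fst c $ i\<bar> < snd c powr - a i" "\<bar>y $ i - fst c $ i\<bar> < snd c powr - a i"
          "\<bar>y $ i - fst c0 $ i\<bar> < snd c0 powr - a i"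
          using y c by (auto simp: mem_scaled_box)
        ultimately show ?thesis by linarith
      qed
      then show ?thesis by blast
    qed
    have "(\<Union>c\<in>F. scaled_box a c)
        \<subseteq> (\<Union>c\<in>insert c0 S. {x. \<forall>i. \<bar>x $ i - fst c $ i\<bar> < 3 * snd c powr - a i})"
    proof (rule UN_least)
      fix c assume "c \<in> F"
      show "scaled_box a c \<subseteq> (\<Union>c\<in>insert c0 S. {x. \<forall>i. \<bar>x $ i - fst c $ i\<bar> < 3 * snd c powr - a i})"
      proof (cases "c \<in> F'")
        case True
        then have "scaled_box a c \<subseteq> (\<Union>c\<in>F'. scaled_box a c)" by (rule UN_upper)
        also note S(3)
        finally show ?thesis by (rule order_trans) (rule UN_mono, auto)
      next
        case False
        then have "scaled_box a c \<subseteq> {x. \<forall>i. \<bar>x $ i - fst c0 $ i\<bar> < 3 * snd c0 powr - a i}"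
          using hit[OF \<open>c \<in> F\<close>] by (intro subsetI)
        then show ?thesis by (rule order_trans) (rule UN_upper, simp)
      qed
    qed
    moreover have "disjoint_family_on (scaled_box a) (insert c0 S)"
      using S unfolding disjoint_family_on_def F'_def by blast
    moreover have "insert c0 S \<subseteq> F" using S c0 \<open>F' \<subset> F\<close> by blast
    ultimately show ?thesis by blast
  qed
qed

text \<open>A compact \<open>T\<close> inside \<open>D - N\<close> carries at least half of the
  measure of \<open>D\<close> and needs only finitely many boxes. The disjoint subfamily from
  \<open>scaled_boxes_vitali\<close> covers \<open>T\<close> after tripling, whence the factors 2
  and \<open>3 ^ CARD('d)\<close>.\<close>

lemma scaled_boxes_packing:
  fixes a :: "'d::finite \<Rightarrow> real" and D :: "(real ^ 'd) set"
  assumes D: "open D" "bounded D" "D \<noteq> {}" and a: "\<And>i. 0 \<le> a i" and N: "N \<in> null_sets lebesgue"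
    and G: "\<And>c. c \<in> G \<Longrightarrow> 0 < snd c \<and> scaled_box a c \<subseteq> D"
    and cover: "D - N \<subseteq> (\<Union>c\<in>G. scaled_box a c)"
  shows "\<exists>S\<subseteq>G. finite S \<and> disjoint_family_on (scaled_box a) S \<and>
    measure lborel D \<le> 2 * 3 ^ CARD('d) * (\<Sum>c\<in>S. measure lborel (scaled_box a c))"
proof -
  have DN: "D - N \<in> lmeasurable" using D N by (intro fmeasurable_Diff lmeasurable_open) (auto simp: null_setsD2)
  have mDN: "measure lebesgue (D - N) = measure lebesgue D"
    using D N by (intro measure_Diff_null_set) auto
  define e where "e = measure lebesgue D / 2"
  have "0 < e"
    using D open_not_negligible[of D] negligible_iff_measure0[OF lmeasurable_open[of D]]
    by (simp add: e_def order.strict_iff_order)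
  then obtain T where T: "closed T" "T \<subseteq> D - N" "(D - N) - T \<in> lmeasurable" "emeasure lebesgue ((D - N) - T) < ennreal e"
    using sets_lebesgue_inner_closed[of "D - N" e] DN by (auto simp: fmeasurableD)
  have "compact T" using T D by (meson Diff_subset bounded_subset compact_eq_bounded_closed subset_trans)
  have "measure lebesgue ((D - N) - T) < e"
    using T \<open>0 < e\<close> by (simp add: emeasure_eq_measure2 ennreal_less_iff)
  moreover have "measure lebesgue ((D - N) - T) = measure lebesgue (D - N) - measure lebesgue T"
    using T DN \<open>compact T\<close> by (intro measurable_measure_Diff) (auto simp: lmeasurable_compact fmeasurableD)
  ultimately have half: "measure lebesgue D \<le> 2 * measure lebesgue T" by (simp add: mDN e_def)
  have "T \<subseteq> (\<Union>c\<in>G. scaled_box a c)" using T cover by blast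
  then obtain F where F: "F \<subseteq> G" "finite F" "T \<subseteq> (\<Union>c\<in>F. scaled_box a c)"
    using compactE_image[OF \<open>compact T\<close>, of G "scaled_box a"] open_scaled_box by metis
  define W where "W c = box (\<chi> i. fst c $ i - 3 * snd c powr - a i) (\<chi> i. fst c $ i + 3 * snd c powr - a i)" for c :: "(real ^ 'd) \<times> real"
  have W: "{x. \<forall>i. \<bar>x $ i - fst c $ i\<bar> < 3 * snd c powr - a i} = W c" for c
  proof (rule set_eqI)
    fix x
    have "\<bar>x $ i - fst c $ i\<bar> < 3 * snd c powr - a i \<longleftrightarrow>
        fst c $ i - 3 * snd c powr - a i < x $ i \<and> x $ i < fst c $ i + 3 * snd c powr - a i" for i
      by linarith
    then show "x \<in> {x. \<forall>i. \<bar>x $ i - fst c $ i\<bar> < 3 * snd c powr - a i} \<longleftrightarrow> x \<in> W c"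
      by (simp add: W_def mem_box_cart)
  qed
  have F_pos: "0 < snd c" if "c \<in> F" for c using F G that by blast
  from scaled_boxes_vitali[of F a, OF F(2) a F_pos]
  obtain S where S: "S \<subseteq> F" "disjoint_family_on (scaled_box a) S" "(\<Union>c\<in>F. scaled_box a c) \<subseteq> (\<Union>c\<in>S. W c)"
    unfolding W by (auto simp del: Union_iff UN_iff)
  have fin: "finite S" using S F finite_subset by blast
  have "measure lebesgue T \<le> measure lebesgue (\<Union>c\<in>S. W c)"
    using S F \<open>compact T\<close> fin by (intro measure_mono_fmeasurable) (auto simp: W_def lmeasurable_compact fmeasurableD)
  also have "\<dots> \<le> (\<Sum>c\<in>S. measure lebesgue (W c))"
    using fin by (intro measure_UNION_le) (auto simp: W_def)
  also have "\<dots> = (\<Sum>c\<in>S. 3 ^ CARD('d) * measure lborel (scaled_box a c))"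
  proof (rule sum.cong)
    fix c :: "(real ^ 'd) \<times> real"
    have "(\<Prod>i\<in>(UNIV::'d set). 6 * snd c powr - a i) = 3 ^ CARD('d) * 2 ^ CARD('d) * (\<Prod>i\<in>UNIV. snd c powr - a i)"
      using power_mult_distrib[of "3::real" 2 "CARD('d)"] by (simp add: prod.distrib)
    then show "measure lebesgue (W c) = 3 ^ CARD('d) * measure lborel (scaled_box a c)"
      by (simp add: W_def measure_cbox_vec measure_scaled_box)
  qed simp
  also have "\<dots> = 3 ^ CARD('d) * (\<Sum>c\<in>S. measure lborel (scaled_box a c))"
    by (simp add: sum_distrib_left)
  finally have "measure lborel D \<le> 2 * 3 ^ CARD('d) * (\<Sum>c\<in>S. measure lborel (scaled_box a c))"
    using half D by simp
  then show ?thesis using S F fin by blast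
qed

section \<open>Mass transference\<close>

text \<open>The exponents \<open>a\<close> give the long boxes, which cover almost all of
  \<open>D\<close> with arbitrarily large denominators; \<open>b\<close> gives the short boxes,
  whose limsup set is to be measured. \<open>ex\<close> is the local mass condition for the exponent
  \<open>s\<close>, and the conclusion is drawn for a smaller \<open>s'\<close>.\<close>

locale box_transfer =
  fixes a b :: "'d::finite \<Rightarrow> real" and G :: "((real ^ 'd) \<times> real) set"
    and D N :: "(real ^ 'd) set" and s s' :: real
  assumes D: "open D" "D \<noteq> {}"
    and a: "\<And>i. 0 < a i" and ab: "\<And>i. a i < b i"
    and ex: "\<And>t. 0 \<le> t \<Longrightarrow> s * t \<le> (\<Sum>i\<in>UNIV. min (a i) t + max 0 (t - b i))"
    and s: "0 \<le> s'" "s' < s"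
    and N: "N \<in> null_sets lebesgue"
    and cover: "\<And>x Q. x \<in> D - N \<Longrightarrow> \<exists>c\<in>G. Q \<le> snd c \<and> x \<in> scaled_box a c"
begin

text \<open>The constant of \<open>scaled_boxes_packing\<close>.\<close>

definition \<kappa> :: real where "\<kappa> = 2 * 3 ^ CARD('d)"

lemma \<kappa>_pos: "0 < \<kappa>" by (simp add: \<kappa>_def)

text \<open>\<open>1 < snd c\<close> puts the short box inside the long one,
  \<open>1 / \<rho> \<le> snd c\<close> drives the denominators to infinity along the levels, and
  sides at most \<open>\<rho>\<close> keep a long box that meets a set of diameter
  \<open>r \<ge> \<rho>\<close> near that set.\<close>

definition small_box :: "real \<Rightarrow> (real ^ 'd) \<times> real \<Rightarrow> bool" where
  "small_box \<rho> c \<longleftrightarrow> 1 < snd c \<and> 1 / \<rho> \<le> snd c \<and> (\<forall>i. 2 * snd c powr - a i \<le> \<rho>)"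

text \<open>One level of the Cantor construction. The short boxes carry the masses, but disjointness
  is asked of the long ones, since the local estimate adds up their volumes.
  \<open>\<rho> \<le> 1/2\<close> ensures \<open>2 * r \<le> 1\<close> when that estimate is applied
  to a doubled radius.\<close>

definition family :: "((real ^ 'd) \<times> real) set \<Rightarrow> ((real ^ 'd) \<times> real \<Rightarrow> real) \<Rightarrow> real \<Rightarrow> bool" where
  "family S m \<rho> \<longleftrightarrow> finite S \<and> S \<subseteq> G \<and> disjoint_family_on (scaled_box a) S \<and>
     (\<forall>c\<in>S. small_box \<rho> c \<and> scaled_cbox b c \<subseteq> D \<and> 0 \<le> m c) \<and> (\<Sum>c\<in>S. m c) = 1 \<and> 0 < \<rho> \<and> \<rho> \<le> 1/2"

text \<open>Parenthood is read off from inclusion, so the levels carry no separate tree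
  structure.\<close>

definition children :: "((real ^ 'd) \<times> real) set \<Rightarrow> (real ^ 'd) \<times> real \<Rightarrow> ((real ^ 'd) \<times> real) set" where
  "children S' c = {c'\<in>S'. scaled_box a c' \<subseteq> scaled_cbox b c}"

text \<open>
  The new scale \<open>\<rho>'\<close> is chosen after the masses \<open>m\<close> are known, so the gap \<open>s' < s\<close> absorbs both
  the density of the old masses and the packing constant: this is the last clause.
\<close>

definition refines where
  "refines S m \<rho> S' m' \<rho>' \<longleftrightarrow> \<rho>' \<le> \<rho> / 2 \<and> S' = (\<Union>c\<in>S. children S' c) \<and>
     (\<forall>c\<in>S. (\<Sum>c'\<in>children S' c. m' c') = m c \<and>
       (\<forall>c'\<in>children S' c. m' c' * measure lborel (scaled_cbox b c) \<le> \<kappa> * m c * measure lborel (scaled_box a c'))) \<and>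
     (\<forall>c'\<in>S'. m' c' \<le> \<rho>' powr (s' - s) * measure lborel (scaled_box a c'))"

lemma cbox_subset_box: "1 < snd c \<Longrightarrow> scaled_cbox b c \<subseteq> scaled_box a c"
  by (rule scaled_cbox_subset_box[OF ab])

lemma small_box_eventually: "0 < \<rho> \<Longrightarrow> \<exists>Q. \<forall>c. Q \<le> snd c \<longrightarrow> small_box \<rho> c"
proof -
  assume \<rho>: "0 < \<rho>"
  have "\<forall>\<^sub>F q in at_top. 2 * q powr - a i < \<rho>" for i
  proof -
    have "((\<lambda>q. 2 * q powr - a i) \<longlongrightarrow> 2 * 0) at_top"
      using a by (intro tendsto_mult tendsto_const tendsto_neg_powr filterlim_ident) auto
    then show ?thesis using \<rho> by (intro order_tendstoD) auto
  qed
  then have "\<forall>\<^sub>F q in at_top. \<forall>i. 2 * q powr - a i < \<rho>" by (simp add: eventually_all_finite)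
  then have "\<forall>\<^sub>F q in at_top. 1 < q \<and> 1 / \<rho> \<le> q \<and> (\<forall>i. 2 * q powr - a i \<le> \<rho>)"
    using eventually_gt_at_top[of 1] eventually_ge_at_top[of "1 / \<rho>"]
    by eventually_elim (auto simp: less_imp_le)
  then show ?thesis by (auto simp: small_box_def eventually_at_top_linorder)
qed

lemma scaled_box_in_open:
  assumes "open O'" "x \<in> O'"
  shows "\<exists>Q. \<forall>c. Q \<le> snd c \<longrightarrow> x \<in> scaled_box a c \<longrightarrow> scaled_box a c \<subseteq> O'"
proof -
  obtain e where e: "0 < e" "ball x e \<subseteq> O'" using assms openE by blast
  have "0 < e / (2 * CARD('d))" using e by simp
  then obtain Q where Q: "\<And>c. Q \<le> snd c \<Longrightarrow> small_box (e / (2 * CARD('d))) c"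
    using small_box_eventually by blast
  have "scaled_box a c \<subseteq> O'" if "Q \<le> snd c" "x \<in> scaled_box a c" for c
  proof
    fix y assume y: "y \<in> scaled_box a c"
    have "\<bar>(x - y) $ i\<bar> \<le> e / (2 * CARD('d))" for i
    proof -
      have "\<bar>x $ i - fst c $ i\<bar> < snd c powr - a i" "\<bar>y $ i - fst c $ i\<bar> < snd c powr - a i"
          "2 * snd c powr - a i \<le> e / (2 * CARD('d))"
        using that y Q unfolding mem_scaled_box small_box_def by blast+
      then show ?thesis unfolding vector_minus_component by linarith
    qed
    then have "norm (x - y) \<le> (\<Sum>i\<in>(UNIV::'d set). e / (2 * CARD('d)))"
      by (intro order_trans[OF norm_le_l1_cart] sum_mono)
    then show "y \<in> O'" using e by (auto simp: dist_norm subset_iff)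
  qed
  then show ?thesis by blast
qed

text \<open>Each short box is packed with disjoint long boxes of a finer scale, and its mass is
  divided among them in proportion to volume. The packing has volume at least
  \<open>R c / \<kappa>\<close>, so the new density is at most \<open>\<kappa> * m c / R c\<close>.
  Children of different parents are disjoint because they lie in disjoint long boxes.\<close>

lemma refinement:
  assumes "family S m \<rho>"
  shows "\<exists>S' m' \<rho>'. family S' m' \<rho>' \<and> refines S m \<rho> S' m' \<rho>'"
proof -
  define R where "R c = measure lborel (scaled_cbox b c)" for c :: "(real ^ 'd) \<times> real"
  define P where "P c = measure lborel (scaled_box a c)" for c :: "(real ^ 'd) \<times> real"
  have fin: "finite S" and "S \<subseteq> G" and disj: "disjoint_family_on (scaled_box a) S"
    and fS: "\<And>c. c \<in> S \<Longrightarrow> small_box \<rho> c \<and> scaled_cbox b c \<subseteq> D \<and> 0 \<le> m c" and m1: "sum m S = 1"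
    and \<rho>: "0 < \<rho>" "\<rho> \<le> 1/2"
    using assms by (auto simp: family_def)
  have Rpos: "0 < R c" if "c \<in> S" for c
    using fS[OF that] unfolding R_def measure_scaled_cbox by (auto simp: small_box_def intro!: prod_pos mult_pos_pos)
  \<comment> \<open>A common bound for the new densities: a sum of nonnegative terms dominates each
    of them.\<close>
  define M where "M = (\<Sum>c\<in>S. \<kappa> * m c / R c)"
  have M: "\<kappa> * m c / R c \<le> M" if "c \<in> S" for c
    unfolding M_def using that fin fS Rpos \<kappa>_pos by (intro member_le_sum) (auto intro!: divide_nonneg_pos)
  have "M \<ge> 0" unfolding M_def using fS Rpos \<kappa>_pos by (intro sum_nonneg) (auto intro!: divide_nonneg_pos)
  \<comment> \<open>At the second value the power with exponent \<open>s' - s\<close> equals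
    \<open>M + 1\<close>. The exponent is negative, so a smaller \<open>\<rho>'\<close> only
    increases the power.\<close>
  define \<rho>' where "\<rho>' = min (\<rho> / 2) ((M + 1) powr (- 1 / (s - s')))"
  have \<rho>': "0 < \<rho>'" "\<rho>' \<le> \<rho> / 2" using \<rho> \<open>0 \<le> M\<close> by (auto simp: \<rho>'_def)
  have "M \<le> \<rho>' powr (s' - s)"
  proof -
    have "M \<le> ((M + 1) powr (- 1 / (s - s'))) powr (s' - s)"
    proof -
      have "- 1 / (s - s') * (s' - s) = 1" using s by (simp add: field_simps)
      then show ?thesis using \<open>0 \<le> M\<close> by (simp only: powr_powr powr_one_gt_zero_iff) simp
    qed
    also have "\<dots> \<le> \<rho>' powr (s' - s)"
      using s \<rho>' by (intro powr_mono2') (auto simp: \<rho>'_def)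
    finally show ?thesis .
  qed
  \<comment> \<open>The packing takes place in the open box \<open>scaled_box b c\<close>, whose
    volume equals that of the closed one.\<close>
  have "\<exists>T. T \<subseteq> G \<and> finite T \<and> disjoint_family_on (scaled_box a) T \<and> (\<forall>c'\<in>T. small_box \<rho>' c' \<and> scaled_box a c' \<subseteq> scaled_box b c)
      \<and> R c \<le> \<kappa> * (\<Sum>c'\<in>T. P c')" if "c \<in> S" for c
  proof -
    define G' where "G' = {c'\<in>G. small_box \<rho>' c' \<and> scaled_box a c' \<subseteq> scaled_box b c}"
    have c: "1 < snd c" "scaled_cbox b c \<subseteq> D" using fS[OF that] by (auto simp: small_box_def)
    have bc: "scaled_box b c \<subseteq> scaled_cbox b c" by (auto simp: mem_scaled_box mem_scaled_cbox less_imp_le)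
    have "\<exists>T\<subseteq>G'. finite T \<and> disjoint_family_on (scaled_box a) T \<and>
      measure lborel (scaled_box b c) \<le> 2 * 3 ^ CARD('d) * (\<Sum>c\<in>T. measure lborel (scaled_box a c))"
    proof (rule scaled_boxes_packing[OF _ _ _ _ N])
      have "fst c \<in> scaled_box b c" using c by (auto simp: mem_scaled_box)
      then show "scaled_box b c \<noteq> {}" by blast
      show "bounded (scaled_box b c)" by (simp add: scaled_box_def)
      show "scaled_box b c - N \<subseteq> (\<Union>c\<in>G'. scaled_box a c)"
      proof
        fix x assume x: "x \<in> scaled_box b c - N"
        obtain Q1 where Q1: "\<And>c. Q1 \<le> snd c \<Longrightarrow> small_box \<rho>' c" using small_box_eventually \<rho>' by blast
        obtain Q2 where Q2: "\<And>c'. Q2 \<le> snd c' \<Longrightarrow> x \<in> scaled_box a c' \<Longrightarrow> scaled_box a c' \<subseteq> scaled_box b c"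
          using scaled_box_in_open[of "scaled_box b c" x] x by (metis DiffD1 open_scaled_box)
        obtain c' where "c' \<in> G" "max Q1 Q2 \<le> snd c'" "x \<in> scaled_box a c'"
          using cover[of x "max Q1 Q2"] x bc c by blast
        then show "x \<in> (\<Union>c\<in>G'. scaled_box a c)" using Q1[of c'] Q2[of c'] unfolding G'_def
          by (metis (no_types, lifting) UN_iff max.bounded_iff mem_Collect_eq)
      qed
    qed (auto simp: G'_def small_box_def less_imp_le a)
    then obtain T where T: "T \<subseteq> G'" "finite T" "disjoint_family_on (scaled_box a) T"
      "measure lborel (scaled_box b c) \<le> \<kappa> * (\<Sum>c\<in>T. P c)"
      unfolding \<kappa>_def P_def by blast
    moreover have "measure lborel (scaled_box b c) = R c"
      by (simp add: R_def measure_scaled_box measure_scaled_cbox)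
    ultimately show ?thesis unfolding G'_def by (intro exI[of _ T]) auto
  qed
  then obtain T where T: "\<And>c. c \<in> S \<Longrightarrow> T c \<subseteq> G \<and> finite (T c) \<and> disjoint_family_on (scaled_box a) (T c) \<and>
      (\<forall>c'\<in>T c. small_box \<rho>' c' \<and> scaled_box a c' \<subseteq> scaled_box b c) \<and> R c \<le> \<kappa> * (\<Sum>c'\<in>T c. P c')" by metis
  define S' where "S' = (\<Union>c\<in>S. T c)"
  have bsub: "scaled_box b c \<subseteq> scaled_cbox b c" "scaled_cbox b c \<subseteq> scaled_box a c" if "c \<in> S" for c
    using fS[OF that] cbox_subset_box[of c]
    by (auto simp: mem_scaled_box mem_scaled_cbox less_imp_le small_box_def)
  have center: "fst c' \<in> scaled_box a c'" if "small_box \<rho>' c'" for c'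
    using that by (auto simp: mem_scaled_box small_box_def)
  \<comment> \<open>The centre of the child would lie in the long boxes of both parents, which are
    disjoint if the parents differ.\<close>
  have unique: "c1 = c2" if "c1 \<in> S" "c2 \<in> S" "c' \<in> T c1" "scaled_box a c' \<subseteq> scaled_cbox b c2" for c' c1 c2
  proof (rule ccontr)
    assume "c1 \<noteq> c2"
    then have "scaled_box a c1 \<inter> scaled_box a c2 = {}" using disj that unfolding disjoint_family_on_def by blast
    moreover have "fst c' \<in> scaled_box a c1 \<inter> scaled_box a c2"
      using that T[of c1] center[of c'] bsub[of c1] bsub[of c2] by blast
    ultimately show False by blast
  qed
  have children: "children S' c = T c" if "c \<in> S" for c
  proof
    show "children S' c \<subseteq> T c" using unique[OF _ that] unfolding children_def S'_def by blast
    show "T c \<subseteq> children S' c" using that T[OF that] bsub[OF that] unfolding children_def S'_def by blast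
  qed
  have smallT: "small_box \<rho>' c'" if "c \<in> S" "c' \<in> T c" for c c' using T that by blast
  have Ppos: "0 < P c'" if "small_box \<rho>' c'" for c'
    using that unfolding P_def measure_scaled_box by (auto simp: small_box_def intro!: prod_pos mult_pos_pos)
  define W where "W c = (\<Sum>c'\<in>T c. P c')" for c
  have W: "0 < W c" "R c \<le> \<kappa> * W c" if "c \<in> S" for c
  proof -
    show "R c \<le> \<kappa> * W c" using T[OF that] by (simp add: W_def)
    then show "0 < W c" using Rpos[OF that] \<kappa>_pos by (metis less_le_trans zero_less_mult_pos)
  qed
  \<comment> \<open>Summing over all parents avoids choosing one; for an actual child the index set
    turns out to be a singleton.\<close>
  define m' where "m' c' = (\<Sum>c\<in>{c\<in>S. c' \<in> T c}. m c * P c' / W c)" for c'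
  have m': "m' c' = m c * P c' / W c" if "c \<in> S" "c' \<in> T c" for c c'
  proof -
    have "{c\<in>S. c' \<in> T c} = {c}"
      using unique[OF _ that(1), of _ c'] that children[OF that(1)] unfolding children_def by blast
    then show ?thesis by (simp add: m'_def)
  qed
  have sumT: "(\<Sum>c'\<in>T c. m' c') = m c" if "c \<in> S" for c
  proof -
    have "(\<Sum>c'\<in>T c. m' c') = (\<Sum>c'\<in>T c. m c * P c' / W c)"
      using m' that by (intro sum.cong) auto
    also have "\<dots> = m c * W c / W c" by (simp add: W_def sum_distrib_left flip: sum_divide_distrib)
    finally show ?thesis using W[OF that] by simp
  qed
  have m'0: "0 \<le> m' c'" if "c \<in> S" "c' \<in> T c" for c c'
    using m'[OF that] fS[OF that(1)] W[OF that(1)] by (auto simp: P_def)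
  have le: "m' c' * R c \<le> \<kappa> * m c * P c'" if "c \<in> S" "c' \<in> T c" for c c'
  proof -
    have "m' c' * R c \<le> m' c' * (\<kappa> * W c)"
      by (rule mult_left_mono[OF W(2)[OF that(1)] m'0[OF that]])
    also have "\<dots> = \<kappa> * m c * P c'"
      using W(1)[OF that(1)] unfolding m'[OF that] by (simp add: field_simps)
    finally show ?thesis .
  qed
  have le2: "m' c' \<le> \<rho>' powr (s' - s) * P c'" if "c \<in> S" "c' \<in> T c" for c c'
  proof -
    have "m' c' \<le> \<kappa> * m c / R c * P c'"
      using le[OF that] Rpos[OF that(1)] by (simp add: field_simps)
    also have "\<dots> \<le> \<rho>' powr (s' - s) * P c'"
      using M[OF that(1)] \<open>M \<le> \<rho>' powr (s' - s)\<close> by (intro mult_right_mono) (auto simp: P_def)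
    finally show ?thesis .
  qed
  have disjT: "T c1 \<inter> T c2 = {}" if "c1 \<in> S" "c2 \<in> S" "c1 \<noteq> c2" for c1 c2
    using unique[OF that(1,2)] that(3) children[OF that(2)] unfolding children_def by blast
  have "family S' m' \<rho>'"
    unfolding family_def
  proof (intro conjI ballI)
    show "finite S'" using fin T unfolding S'_def by blast
    show "S' \<subseteq> G" using T unfolding S'_def by blast
    show "disjoint_family_on (scaled_box a) S'"
      unfolding disjoint_family_on_def
    proof (intro ballI impI)
      fix c' c'' assume "c' \<in> S'" "c'' \<in> S'" "c' \<noteq> c''"
      then obtain c1 c2 where c: "c1 \<in> S" "c' \<in> T c1" "c2 \<in> S" "c'' \<in> T c2" by (auto simp: S'_def)
      show "scaled_box a c' \<inter> scaled_box a c'' = {}"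
      proof (cases "c1 = c2")
        case True then show ?thesis using c T[of c1] \<open>c' \<noteq> c''\<close> unfolding disjoint_family_on_def by blast
      next
        case False
        then have "scaled_box a c1 \<inter> scaled_box a c2 = {}" using disj c unfolding disjoint_family_on_def by blast
        moreover have "scaled_box a c' \<subseteq> scaled_box a c1" "scaled_box a c'' \<subseteq> scaled_box a c2"
          using T c bsub by blast+
        ultimately show ?thesis by blast
      qed
    qed
    fix c' assume "c' \<in> S'"
    then obtain c where c: "c \<in> S" "c' \<in> T c" by (auto simp: S'_def)
    show "small_box \<rho>' c'" using smallT c by blast
    then show "scaled_cbox b c' \<subseteq> D"
    proof -
      assume "small_box \<rho>' c'"
      then have "scaled_cbox b c' \<subseteq> scaled_box a c'" by (intro cbox_subset_box) (simp add: small_box_def)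
      then show ?thesis using T[OF c(1)] c bsub[OF c(1)] fS[OF c(1)] by blast
    qed
    show "0 \<le> m' c'" using m'0 c by blast
  next
    show "sum m' S' = 1"
      unfolding S'_def using fin T disjT sumT m1 by (subst sum.UNION_disjoint) (blast, blast, blast, simp)
  qed (use \<rho>' \<rho> in auto)
  moreover have "refines S m \<rho> S' m' \<rho>'"
    unfolding refines_def
  proof (intro conjI ballI)
    show "S' = (\<Union>c\<in>S. children S' c)" using children by (auto simp: S'_def)
    fix c assume c: "c \<in> S"
    show "sum m' (children S' c) = m c" using sumT children c by simp
    show "m' c' * measure lborel (scaled_cbox b c) \<le> \<kappa> * m c * measure lborel (scaled_box a c')"
      if "c' \<in> children S' c" for c' using le[OF c, of c'] that children[OF c] by (simp add: R_def P_def)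
  next
    fix c' assume "c' \<in> S'"
    then show "m' c' \<le> \<rho>' powr (s' - s) * measure lborel (scaled_box a c')"
      using le2 unfolding S'_def P_def by blast
  qed (use \<rho>' in auto)
  ultimately show ?thesis by blast
qed

text \<open>The estimate at scales between two consecutive levels. Children that meet
  \<open>C\<close> have sides at most \<open>\<rho>' \<le> r\<close>, so their long boxes lie in a
  cube \<open>J\<close> of half-side \<open>2 * r\<close>. Disjointness and the density bound leave
  at most \<open>\<kappa> * m c\<close> times the fraction of the parent inside \<open>J\<close>;
  replacing \<open>m c\<close> by its volume bound gives the sum of
  \<open>scaled_boxes_local_mass\<close>. Finally \<open>\<rho> powr (s' - s)\<close> is at most
  \<open>r powr (s' - s)\<close>, as \<open>r \<le> \<rho>\<close> and the exponent is
  negative.\<close>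

lemma mass_estimate:
  assumes fam: "family S m \<rho>" and fam': "family S' m' \<rho>'" and ref: "refines S m \<rho> S' m' \<rho>'"
    and m: "\<And>c. c \<in> S \<Longrightarrow> m c \<le> \<rho> powr (s' - s) * measure lborel (scaled_box a c)"
    and r: "\<rho>' \<le> r" "r \<le> \<rho>" and C: "\<And>x y. x \<in> C \<Longrightarrow> y \<in> C \<Longrightarrow> dist x y \<le> r"
  shows "(\<Sum>c'\<in>{c'\<in>S'. scaled_cbox b c' \<inter> C \<noteq> {}}. m' c') \<le> \<kappa> * 8 ^ CARD('d) * 2 powr s * r powr s'"
proof (cases "C = {}")
  case True
  then show ?thesis using \<kappa>_pos by simp
next
  case False
  then obtain x where x: "x \<in> C" by blast
  define J where "J = cbox (\<chi> i. x $ i - 2 * r) (\<chi> i. x $ i + 2 * r)"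
  define R where "R c = measure lborel (scaled_cbox b c)" for c :: "(real ^ 'd) \<times> real"
  define P where "P c = measure lborel (scaled_box a c)" for c :: "(real ^ 'd) \<times> real"
  have fin: "finite S" "finite S'" and \<rho>: "0 < \<rho>'" "\<rho> \<le> 1/2" and m0: "\<And>c. c \<in> S \<Longrightarrow> 0 \<le> m c"
    and m'0: "\<And>c'. c' \<in> S' \<Longrightarrow> 0 \<le> m' c'"
    and small: "\<And>c. c \<in> S \<Longrightarrow> 1 < snd c" and small': "\<And>c'. c' \<in> S' \<Longrightarrow> small_box \<rho>' c'"
    and disj: "disjoint_family_on (scaled_box a) S" and disj': "disjoint_family_on (scaled_box a) S'"
    using fam fam' unfolding family_def small_box_def by blast+
  have r0: "0 < r" "r \<le> 1/2" using r \<rho> by auto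
  have S': "S' = (\<Union>c\<in>S. children S' c)" using ref by (simp add: refines_def)
  have Rpos: "0 < R c" if "c \<in> S" for c
    using small[OF that] unfolding R_def measure_scaled_cbox by (auto intro!: prod_pos mult_pos_pos)
  have inJ: "scaled_box a c' \<subseteq> J" if c': "c' \<in> S'" "scaled_cbox b c' \<inter> C \<noteq> {}" for c'
  proof
    fix y assume y: "y \<in> scaled_box a c'"
    obtain u where u: "u \<in> scaled_cbox b c'" "u \<in> C" using c' by blast
    have sm: "1 < snd c'" "2 * snd c' powr - a i \<le> \<rho>'" for i
      using small'[OF c'(1)] by (auto simp: small_box_def)
    have "u \<in> scaled_box a c'" using u cbox_subset_box[OF sm(1)] by blast
    have "\<bar>y $ i - x $ i\<bar> \<le> 2 * r" for i
    proof -
      have "\<bar>(u - x) $ i\<bar> \<le> r"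
        using component_le_norm_cart[of "u - x" i] C[OF u(2) x] by (simp add: dist_norm)
      moreover have "\<bar>y $ i - fst c' $ i\<bar> < snd c' powr - a i" "\<bar>u $ i - fst c' $ i\<bar> < snd c' powr - a i"
        using y \<open>u \<in> scaled_box a c'\<close> by (auto simp: mem_scaled_box)
      ultimately show ?thesis using sm(2)[of i] r(1) unfolding vector_minus_component by linarith
    qed
    then show "y \<in> J" by (simp add: J_def mem_box_cart abs_le_iff) (smt (verit))
  qed
  define B where "B c = {c'\<in>children S' c. scaled_box a c' \<subseteq> J}" for c
  have finB: "finite (B c)" for c using fin by (simp add: B_def children_def)
  have BS': "B c \<subseteq> S'" for c by (auto simp: B_def children_def)
  have part: "(\<Sum>c'\<in>B c. m' c') \<le> \<kappa> * \<rho> powr (s' - s) * (P c * measure lborel (scaled_cbox b c \<inter> J) / R c)"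
    if "c \<in> S" for c
  proof -
    have "(\<Sum>c'\<in>B c. m' c') * R c \<le> (\<Sum>c'\<in>B c. \<kappa> * m c * P c')"
      unfolding sum_distrib_right R_def P_def
      using ref that by (intro sum_mono) (auto simp: refines_def B_def)
    also have "\<dots> = \<kappa> * m c * measure lborel (\<Union>c'\<in>B c. scaled_box a c')"
    proof (subst measure_finite_Union)
      show "disjoint_family_on (scaled_box a) (B c)"
        using disj' BS' by (rule disjoint_family_on_mono[rotated])
      show "emeasure lborel (scaled_box a c') \<noteq> \<infinity>" for c'
        unfolding scaled_box_def by (simp add: emeasure_lborel_box_eq)
    qed (use finB in \<open>auto simp: sum_distrib_left P_def scaled_box_def\<close>)
    also have "\<dots> \<le> \<kappa> * m c * measure lborel (scaled_cbox b c \<inter> J)"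
    proof (intro mult_left_mono measure_mono_fmeasurable)
      show "(\<Union>c'\<in>B c. scaled_box a c') \<subseteq> scaled_cbox b c \<inter> J" unfolding B_def children_def by blast
      show "(\<Union>c'\<in>B c. scaled_box a c') \<in> sets lborel"
        using finB by (intro sets.finite_UN) (auto simp: scaled_box_def)
      show "scaled_cbox b c \<inter> J \<in> fmeasurable lborel"
        unfolding scaled_cbox_def J_def by (intro fmeasurable_Int_fmeasurable fmeasurable_cbox) auto
    qed (use \<kappa>_pos m0 that in auto)
    also have "\<dots> \<le> \<kappa> * (\<rho> powr (s' - s) * P c) * measure lborel (scaled_cbox b c \<inter> J)"
      using m[OF that] \<kappa>_pos by (intro mult_right_mono mult_left_mono) (auto simp: P_def)
    finally show ?thesis using Rpos[OF that] by (simp add: field_simps)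
  qed
  have "(\<Sum>c'\<in>{c'\<in>S'. scaled_cbox b c' \<inter> C \<noteq> {}}. m' c') \<le> (\<Sum>c'\<in>(\<Union>c\<in>S. B c). m' c')"
  proof (rule sum_mono2)
    show "{c'\<in>S'. scaled_cbox b c' \<inter> C \<noteq> {}} \<subseteq> (\<Union>c\<in>S. B c)"
    proof
      fix c' assume "c' \<in> {c'\<in>S'. scaled_cbox b c' \<inter> C \<noteq> {}}"
      then have c': "c' \<in> S'" "scaled_box a c' \<subseteq> J" using inJ by simp_all
      from c'(1) obtain c where "c \<in> S" "c' \<in> children S' c" by (subst (asm) S') (erule UN_E)
      then show "c' \<in> (\<Union>c\<in>S. B c)" using c'(2) unfolding B_def by blast
    qed
    show "finite (\<Union>c\<in>S. B c)" using fin finB by blast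
    show "0 \<le> m' c'" if "c' \<in> (\<Union>c\<in>S. B c) - {c'\<in>S'. scaled_cbox b c' \<inter> C \<noteq> {}}" for c'
      using that m'0 BS' by blast
  qed
  also have "\<dots> \<le> (\<Sum>c\<in>S. \<Sum>c'\<in>B c. m' c')"
    using fin(1) finB m'0 BS' by (intro sum_UN_le) blast+
  also have "\<dots> \<le> (\<Sum>c\<in>S. \<kappa> * \<rho> powr (s' - s) * (P c * measure lborel (scaled_cbox b c \<inter> J) / R c))"
    by (intro sum_mono part)
  also have "\<dots> = \<kappa> * \<rho> powr (s' - s) * (\<Sum>c\<in>S. P c * measure lborel (scaled_cbox b c \<inter> J) / R c)"
    by (simp add: sum_distrib_left)
  also have "\<dots> \<le> \<kappa> * \<rho> powr (s' - s) * (8 ^ CARD('d) * (2 * r) powr s)"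
    unfolding P_def R_def J_def
    using scaled_boxes_local_mass[OF ex ab fin(1) small disj, of "2 * r" x] r0 \<kappa>_pos
    by (intro mult_left_mono) auto
  also have "\<rho> powr (s' - s) \<le> r powr (s' - s)"
    using r0 r s by (intro powr_mono2') auto
  also have "\<kappa> * r powr (s' - s) * (8 ^ CARD('d) * (2 * r) powr s) = \<kappa> * 8 ^ CARD('d) * 2 powr s * r powr s'"
    using r0 by (simp add: powr_mult powr_diff)
  finally show ?thesis using \<kappa>_pos by (simp add: mult_left_mono mult_right_mono)
qed

text \<open>A single box of mass 1 suffices, because a density bound is imposed only from the first
  refinement on.\<close>

lemma initial_family: "\<exists>S m \<rho>. family S m \<rho>"
proof -
  have "\<not> negligible D" using D open_not_negligible by blast
  moreover have "negligible N" using N by (simp add: negligible_iff_null_sets)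
  ultimately obtain x where x: "x \<in> D - N" using negligible_subset by blast
  obtain Q1 where Q1: "\<And>c. Q1 \<le> snd c \<Longrightarrow> small_box (1/2) c"
    using small_box_eventually[of "1/2"] by (metis half_gt_zero_iff zero_less_one)
  obtain Q2 where Q2: "\<And>c. Q2 \<le> snd c \<Longrightarrow> x \<in> scaled_box a c \<Longrightarrow> scaled_box a c \<subseteq> D"
    using scaled_box_in_open[of D x] D x by (metis DiffD1)
  obtain c where c: "c \<in> G" "max Q1 Q2 \<le> snd c" "x \<in> scaled_box a c"
    using cover[OF x] by blast
  have "small_box (1/2) c" using Q1 c by simp
  moreover have "scaled_cbox b c \<subseteq> D"
    using cbox_subset_box[of c] Q2[of c] c \<open>small_box (1/2) c\<close> by (auto simp: small_box_def)
  ultimately have "family {c} (\<lambda>_. 1) (1/2)"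
    using c by (simp add: family_def disjoint_family_on_def)
  then show ?thesis by blast
qed

text \<open>Dependent choice iterates \<open>refinement\<close>. As \<open>\<rho> n\<close> tends to
  0 and \<open>1 / \<rho> n \<le> snd c\<close> at level \<open>n\<close>, a point of all levels
  lies in short boxes of arbitrarily large denominator. The required mass bounds come from
  \<open>mass_estimate\<close> at the level whose scales enclose \<open>r\<close>.\<close>

theorem limsup_hausdorff_measure_pos:
  assumes sup: "{x\<in>D. \<forall>Q. \<exists>c\<in>G. Q \<le> snd c \<and> x \<in> scaled_cbox b c} \<subseteq> A"
  shows "hausdorff_measure s' A \<noteq> 0"
proof -
  define fam where "fam \<sigma> = (case \<sigma> of (S, m, \<rho>) \<Rightarrow> family S m \<rho>)" for \<sigma>
  define refi where "refi \<sigma> \<sigma>' = (case \<sigma> of (S, m, \<rho>) \<Rightarrow> case \<sigma>' of (S', m', \<rho>') \<Rightarrow> refines S m \<rho> S' m' \<rho>')" for \<sigma> \<sigma>'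
  have init: "\<exists>\<sigma>. fam \<sigma>" using initial_family by (auto simp: fam_def)
  have step: "\<exists>\<sigma>'. fam \<sigma>' \<and> refi \<sigma> \<sigma>'" if "fam \<sigma>" for \<sigma>
    using refinement that by (auto simp: fam_def refi_def split: prod.splits)
  have "\<exists>\<sigma>. \<forall>n. fam (\<sigma> n) \<and> refi (\<sigma> n) (\<sigma> (Suc n))"
    by (rule dependent_nat_choice) (use init step in auto)
  then obtain \<sigma> where \<sigma>: "\<And>n. fam (\<sigma> n)" "\<And>n. refi (\<sigma> n) (\<sigma> (Suc n))" by blast
  define S where "S n = fst (\<sigma> n)" for n
  define m where "m n = fst (snd (\<sigma> n))" for n
  define \<rho> where "\<rho> n = snd (snd (\<sigma> n))" for n
  have fam: "family (S n) (m n) (\<rho> n)" and ref: "refines (S n) (m n) (\<rho> n) (S (Suc n)) (m (Suc n)) (\<rho> (Suc n))" for n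
    using \<sigma>[of n] by (auto simp: fam_def refi_def S_def m_def \<rho>_def split: prod.splits)
  have fin: "finite (S n)" and SG: "S n \<subseteq> G" and sm: "\<And>c. c \<in> S n \<Longrightarrow> small_box (\<rho> n) c" and m1: "sum (m n) (S n) = 1"
    and m0: "\<And>c. c \<in> S n \<Longrightarrow> 0 \<le> m n c" and inD: "\<And>c. c \<in> S n \<Longrightarrow> scaled_cbox b c \<subseteq> D" and \<rho>pos: "0 < \<rho> n" for n
    using fam[of n] unfolding family_def by blast+
  have \<rho>half: "\<rho> (Suc n) \<le> \<rho> n / 2" and Schild: "S (Suc n) = (\<Union>c\<in>S n. children (S (Suc n)) c)"
    and msum: "\<And>c. c \<in> S n \<Longrightarrow> sum (m (Suc n)) (children (S (Suc n)) c) = m n c"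
    and mbd: "\<And>c. c \<in> S (Suc n) \<Longrightarrow> m (Suc n) c \<le> \<rho> (Suc n) powr (s' - s) * measure lborel (scaled_box a c)" for n
    using ref[of n] unfolding refines_def by blast+
  have \<rho>le: "\<rho> n \<le> (1/2) ^ n" for n
  proof (induction n)
    case 0 show ?case using fam[of 0] by (simp add: family_def)
  next
    case (Suc n) then show ?case using \<rho>half[of n] by simp
  qed
  have \<rho>lim: "\<exists>n. \<rho> n < e" if e: "0 < e" for e
  proof -
    obtain n where "(1/2) ^ n < e" using real_arch_pow_inv[of e "1/2"] e by auto
    then show ?thesis using \<rho>le[of n] by (intro exI[of _ n]) linarith
  qed
  have sub: "scaled_cbox b c' \<subseteq> scaled_cbox b c" if "c' \<in> children (S n) c" for c c' n
    using that sm[of c' n] cbox_subset_box[of c'] unfolding children_def small_box_def by blast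
  show ?thesis
  \<comment> \<open>Level 0 has no density bound, so the mass estimates start at level 1 and
    \<open>\<rho> 1\<close> is the largest admissible scale.\<close>
  proof (rule hausdorff_measure_pos_of_levels[where S = S and R = "scaled_cbox b" and m = m
        and \<delta> = "\<rho> 1" and K = "\<kappa> * 8 ^ CARD('d) * 2 powr s"])
    show "scaled_cbox b c \<noteq> {}" if "c \<in> S j" for j c
    proof -
      have "fst c \<in> scaled_cbox b c" by (simp add: mem_scaled_cbox)
      then show ?thesis by blast
    qed
    show "(\<Union>c\<in>S (Suc j). scaled_cbox b c) \<subseteq> (\<Union>c\<in>S j. scaled_cbox b c)" for j
      using Schild[of j] sub by blast
    \<comment> \<open>The parent of a child that meets \<open>C\<close> meets \<open>C\<close> as
      well, and the children of a box share exactly its mass.\<close>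
    show "sum (m (Suc j)) {c\<in>S (Suc j). scaled_cbox b c \<inter> C \<noteq> {}} \<le> sum (m j) {c\<in>S j. scaled_cbox b c \<inter> C \<noteq> {}}" for j C
    proof -
      let ?ch = "children (S (Suc j))"
      have finch: "finite (?ch c)" for c using fin by (simp add: children_def)
      have chS: "?ch c \<subseteq> S (Suc j)" for c by (auto simp: children_def)
      have "sum (m (Suc j)) {c\<in>S (Suc j). scaled_cbox b c \<inter> C \<noteq> {}}
          \<le> sum (m (Suc j)) (\<Union>c\<in>{c\<in>S j. scaled_cbox b c \<inter> C \<noteq> {}}. ?ch c)"
      proof (rule sum_mono2)
        show "{c\<in>S (Suc j). scaled_cbox b c \<inter> C \<noteq> {}} \<subseteq> (\<Union>c\<in>{c\<in>S j. scaled_cbox b c \<inter> C \<noteq> {}}. ?ch c)"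
          using Schild[of j] sub by blast
        show "finite (\<Union>c\<in>{c\<in>S j. scaled_cbox b c \<inter> C \<noteq> {}}. ?ch c)" using fin finch by simp
        show "0 \<le> m (Suc j) c" if "c \<in> (\<Union>c\<in>{c\<in>S j. scaled_cbox b c \<inter> C \<noteq> {}}. ?ch c)
            - {c\<in>S (Suc j). scaled_cbox b c \<inter> C \<noteq> {}}" for c
          using that m0 chS by blast
      qed
      also have "\<dots> \<le> (\<Sum>c\<in>{c\<in>S j. scaled_cbox b c \<inter> C \<noteq> {}}. sum (m (Suc j)) (?ch c))"
      proof (rule sum_UN_le)
        show "0 \<le> m (Suc j) x" if "x \<in> ?ch c" for x c using that m0 chS by blast
      qed (use fin finch in auto)
      also have "\<dots> = sum (m j) {c\<in>S j. scaled_cbox b c \<inter> C \<noteq> {}}"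
        using msum by (intro sum.cong) auto
      finally show ?thesis .
    qed
    show "\<exists>j. sum (m j) {c\<in>S j. scaled_cbox b c \<inter> C \<noteq> {}} \<le> \<kappa> * 8 ^ CARD('d) * 2 powr s * r powr s'"
      if r: "0 < r" "r \<le> \<rho> 1" and C: "\<And>x y. x \<in> C \<Longrightarrow> y \<in> C \<Longrightarrow> dist x y \<le> r" for C r
    proof -
      \<comment> \<open>Minimality gives \<open>\<rho> (j + 2) \<le> r \<le> \<rho> (j + 1)\<close>;
        for \<open>j = 0\<close> the upper bound is the hypothesis
        \<open>r \<le> \<rho> 1\<close>.\<close>
      define j where "j = (LEAST j. \<rho> (Suc (Suc j)) \<le> r)"
      have ex: "\<exists>j. \<rho> (Suc (Suc j)) \<le> r"
      proof -
        obtain n where "\<rho> n < r" using \<rho>lim r by blast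
        moreover have "\<rho> (Suc (Suc n)) \<le> \<rho> n"
          using \<rho>half[of n] \<rho>half[of "Suc n"] \<rho>pos[of n] \<rho>pos[of "Suc n"] by linarith
        ultimately show ?thesis by (intro exI[of _ n]) linarith
      qed
      then have j: "\<rho> (Suc (Suc j)) \<le> r" unfolding j_def by (rule LeastI_ex)
      have "r \<le> \<rho> (Suc j)"
      proof (cases j)
        case 0 then show ?thesis using r by simp
      next
        case (Suc k)
        then have "\<not> \<rho> (Suc (Suc k)) \<le> r" using not_less_Least[of k "\<lambda>j. \<rho> (Suc (Suc j)) \<le> r"] j_def by simp
        then show ?thesis using Suc by simp
      qed
      then show ?thesis
        using mass_estimate[OF fam[of "Suc j"] fam[of "Suc (Suc j)"] ref[of "Suc j"] mbd[of _ j] j _ C] by blast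
    qed
    show "(\<Inter>j. \<Union>c\<in>S j. scaled_cbox b c) \<subseteq> A"
    proof
      fix x assume x: "x \<in> (\<Inter>j. \<Union>c\<in>S j. scaled_cbox b c)"
      have "x \<in> D" using x inD by blast
      moreover have "\<exists>c\<in>G. Q \<le> snd c \<and> x \<in> scaled_cbox b c" for Q
      proof -
        define M where "M = max 1 Q"
        have "0 < M" "Q \<le> M" by (auto simp: M_def)
        then obtain n where n: "\<rho> n < 1 / M" using \<rho>lim[of "1 / M"] by auto
        obtain c where c: "c \<in> S n" "x \<in> scaled_cbox b c" using x by blast
        note \<open>Q \<le> M\<close>
        also have "M < 1 / \<rho> n" using n \<rho>pos[of n] \<open>0 < M\<close> by (simp add: field_simps)
        also have "\<dots> \<le> snd c" using sm[OF c(1)] by (simp add: small_box_def)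
        finally show ?thesis using c SG by (intro bexI[of _ c]) auto
      qed
      ultimately show "x \<in> A" using sup by blast
    qed
  qed (use fin m0 m1 s \<rho>pos \<kappa>_pos in auto)
qed

end

section \<open>Exponents\<close>

text \<open>The right-hand side is convex and piecewise linear in \<open>t\<close>, so only its breakpoints matter.\<close>

lemma breakpoint_bound:
  fixes \<beta> :: "'d::finite \<Rightarrow> real"
  assumes bp: "\<And>i. s * \<beta> i \<le> B + (\<Sum>k\<in>UNIV. max 0 (\<beta> i - \<beta> k))"
    and s: "s \<le> real CARD('d)" and "0 \<le> B" "0 \<le> t"
  shows "s * t \<le> B + (\<Sum>k\<in>UNIV. max 0 (t - \<beta> k))"
proof -
  \<comment> \<open>The slope of the sum just to the right of \<open>t\<close>. If
    \<open>s \<le> c\<close>, the bound is carried forward from the last breakpoint up to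
    \<open>t\<close>, since from there the sum grows at least at rate \<open>s\<close>; if there is
    no such breakpoint, then \<open>s \<le> 0\<close>.\<close>
  define c where "c = real (card {k. \<beta> k \<le> t})"
  have c: "(\<Sum>k\<in>UNIV. if \<beta> k \<le> t then u else 0) = c * u" for u
    by (simp add: c_def flip: sum.inter_filter)
  show ?thesis
  proof (cases "s \<le> c")
    case True
    show ?thesis
    proof (cases "{k. \<beta> k \<le> t} = {}")
      case True
      then have "s \<le> 0" using \<open>s \<le> c\<close> by (simp add: c_def)
      then have "s * t \<le> 0" using \<open>0 \<le> t\<close> by (rule mult_nonpos_nonneg)
      moreover have "0 \<le> (\<Sum>k\<in>UNIV. max 0 (t - \<beta> k))" by (simp add: sum_nonneg)
      ultimately show ?thesis using \<open>0 \<le> B\<close> by linarith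
    next
      case False
      then have "Max (\<beta> ` {k. \<beta> k \<le> t}) \<in> \<beta> ` {k. \<beta> k \<le> t}" by (intro Max_in) auto
      then obtain j where j: "\<beta> j \<le> t" "\<beta> j = Max (\<beta> ` {k. \<beta> k \<le> t})" by force
      have jmax: "\<beta> k \<le> \<beta> j" if "\<beta> k \<le> t" for k using that j(2) by simp
      have "(\<Sum>k\<in>UNIV. max 0 (t - \<beta> k)) = (\<Sum>k\<in>UNIV. max 0 (\<beta> j - \<beta> k) + (if \<beta> k \<le> t then t - \<beta> j else 0))"
        using jmax j(1) by (intro sum.cong) (auto simp: max_def)
      also have "\<dots> = (\<Sum>k\<in>UNIV. max 0 (\<beta> j - \<beta> k)) + c * (t - \<beta> j)" by (simp add: sum.distrib c)
      finally have "B + (\<Sum>k\<in>UNIV. max 0 (t - \<beta> k)) \<ge> s * \<beta> j + s * (t - \<beta> j)"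
        using bp[of j] mult_right_mono[OF True, of "t - \<beta> j"] j(1) by linarith
      then show ?thesis by (simp add: algebra_simps)
    qed
  next
    \<comment> \<open>Now the sum grows more slowly than rate \<open>s\<close> up to the next
      breakpoint, so the bound there is carried back to \<open>t\<close>. A next breakpoint exists,
      because past the last one the slope is \<open>CARD('d) \<ge> s\<close>.\<close>
    case False
    have "{k. t < \<beta> k} \<noteq> {}"
    proof
      assume "{k. t < \<beta> k} = {}"
      then have "{k. \<beta> k \<le> t} = UNIV" by (auto simp: not_less)
      then show False using False s by (simp add: c_def)
    qed
    then have "Min (\<beta> ` {k. t < \<beta> k}) \<in> \<beta> ` {k. t < \<beta> k}" by (intro Min_in) auto
    then obtain j where j: "t < \<beta> j" "\<beta> j = Min (\<beta> ` {k. t < \<beta> k})" by force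
    have jmin: "\<beta> j \<le> \<beta> k" if "t < \<beta> k" for k using that j(2) by simp
    have "max 0 (\<beta> j - \<beta> k) = max 0 (t - \<beta> k) + (if \<beta> k \<le> t then \<beta> j - t else 0)" for k
      using jmin[of k] j(1) by (auto simp: max_def)
    then have "(\<Sum>k\<in>UNIV. max 0 (\<beta> j - \<beta> k)) = (\<Sum>k\<in>UNIV. max 0 (t - \<beta> k)) + c * (\<beta> j - t)"
      by (simp add: sum.distrib c)
    then have "s * \<beta> j \<le> B + (\<Sum>k\<in>UNIV. max 0 (t - \<beta> k)) + s * (\<beta> j - t)"
      using bp[of j] mult_right_mono[of c s "\<beta> j - t"] False j(1) by linarith
    then show ?thesis by (simp add: algebra_simps)
  qed
qed

text \<open>
  The weights \<open>v\<close> are the capped exponents \<open>min (\<tau> i) \<theta>\<close> with total \<open>1 - \<sigma>\<close>, lowered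
  by \<open>\<eta>\<close> to leave room for the constants in Dirichlet's theorem.
\<close>

lemma exponents_exist:
  fixes \<tau> :: "'d::finite \<Rightarrow> real" and \<sigma> s s0 :: real
  assumes \<tau>: "\<And>i. 0 < \<tau> i" and \<sigma>: "\<sigma> < 1" "1 \<le> sum \<tau> UNIV + \<sigma>"
    and s0: "\<And>i. s0 * (1 + \<tau> i) \<le> CARD('d) + 1 - \<sigma> + (\<Sum>k\<in>UNIV. max 0 (\<tau> i - \<tau> k))"
    and s: "s < s0" "s0 \<le> CARD('d)"
  shows "\<exists>v \<eta>. 0 < \<eta> \<and> (\<forall>i. 0 < v i \<and> v i \<le> \<tau> i) \<and> sum v UNIV + \<sigma> + \<eta> \<le> 1 \<and>
    (\<forall>t\<ge>0. s * t \<le> (\<Sum>i\<in>UNIV. min (1 + v i) t + max 0 (t - (1 + \<tau> i + \<eta>))))"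
proof -
  define d where "d = real CARD('d)"
  have d: "1 \<le> d" unfolding d_def by (simp add: Suc_leI)
  define T where "T = Max (range \<tau>)"
  have T: "\<tau> i \<le> T" for i by (simp add: T_def)
  have "0 < T" using \<tau> T by (meson less_le_trans)
  have zero: "(\<Sum>i\<in>UNIV. min (\<tau> i) 0) = 0" using \<tau> by (simp add: min_absorb2 less_imp_le)
  \<comment> \<open>The capped total runs continuously from 0 to the full sum of the exponents,
    which is at least \<open>1 - \<sigma>\<close>.\<close>
  have "\<exists>\<theta>\<ge>0. \<theta> \<le> T \<and> (\<Sum>i\<in>UNIV. min (\<tau> i) \<theta>) = 1 - \<sigma>"
  proof (rule IVT')
    show "(\<Sum>i\<in>UNIV. min (\<tau> i) 0) \<le> 1 - \<sigma>" using zero \<sigma> by simp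
    show "1 - \<sigma> \<le> (\<Sum>i\<in>UNIV. min (\<tau> i) T)" using T \<sigma> by (simp add: min_absorb1)
    show "continuous_on {0..T} (\<lambda>\<theta>. \<Sum>i\<in>UNIV. min (\<tau> i) \<theta>)" by (intro continuous_intros)
  qed (use \<open>0 < T\<close> in simp)
  then obtain \<theta> where \<theta>: "0 \<le> \<theta>" "(\<Sum>i\<in>UNIV. min (\<tau> i) \<theta>) = 1 - \<sigma>" by blast
  have "\<theta> \<noteq> 0"
    using \<theta> \<sigma> zero by auto
  then have "0 < \<theta>" using \<theta> by simp
  define M where "M = Min (range (\<lambda>i. min (\<tau> i) \<theta>))"
  have "0 < M" using \<tau> \<open>0 < \<theta>\<close> by (simp add: M_def)
  have M: "M \<le> min (\<tau> i) \<theta>" for i unfolding M_def by (intro Min_le) auto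
  \<comment> \<open>Half of \<open>M\<close> keeps every \<open>v i\<close> positive. The other
    bound limits the loss \<open>2 * d * \<eta>\<close> from perturbing both families of exponents,
    which the gap \<open>(s0 - s) * t\<close> repays once \<open>t \<ge> 1\<close>.\<close>
  define \<eta> where "\<eta> = min (M / 2) ((s0 - s) / (2 * d))"
  have \<eta>: "0 < \<eta>" "\<eta> < M" "2 * d * \<eta> \<le> s0 - s"
    using \<open>0 < M\<close> s d by (auto simp: \<eta>_def min_def field_simps)
  define v where "v i = min (\<tau> i) \<theta> - \<eta>" for i
  have v: "0 < v i" "v i \<le> \<tau> i" for i using M[of i] \<eta> by (auto simp: v_def)
  have "sum v UNIV = 1 - \<sigma> - d * \<eta>" by (simp add: v_def sum_subtractf \<theta> d_def)
  moreover have "\<eta> \<le> d * \<eta>" using d \<eta> by simp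
  ultimately have "sum v UNIV + \<sigma> + \<eta> \<le> 1" by linarith
  moreover have "s * t \<le> (\<Sum>i\<in>UNIV. min (1 + v i) t + max 0 (t - (1 + \<tau> i + \<eta>)))" if t: "0 \<le> t" for t
  proof (cases "t \<le> 1")
    case True
    have "s * t \<le> d * t" using s t by (intro mult_right_mono) (auto simp: d_def)
    also have "\<dots> = (\<Sum>i\<in>(UNIV::'d set). t)" by (simp add: d_def)
    also have "\<dots> \<le> (\<Sum>i\<in>UNIV. min (1 + v i) t + max 0 (t - (1 + \<tau> i + \<eta>)))"
      using True v by (intro sum_mono) (auto simp: min_def add_increasing2 less_imp_le intro: order_trans)
    finally show ?thesis .
  next
    case False
    \<comment> \<open>Up to \<open>1 + \<theta>\<close> every summand is at least \<open>t\<close>,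
      and \<open>s0 \<le> d\<close> suffices. Beyond it the capped terms are constant with total
      \<open>d + 1 - \<sigma>\<close>, the value of \<open>B\<close> in
      \<open>breakpoint_bound\<close>.\<close>
    have "s0 * t \<le> (\<Sum>i\<in>UNIV. min (1 + min (\<tau> i) \<theta>) t + max 0 (t - (1 + \<tau> i)))"
    proof (cases "t \<le> 1 + \<theta>")
      case True
      have "s0 * t \<le> d * t" using s t by (intro mult_right_mono) (auto simp: d_def)
      also have "\<dots> = (\<Sum>i\<in>(UNIV::'d set). t)" by (simp add: d_def)
      also have "\<dots> \<le> (\<Sum>i\<in>UNIV. min (1 + min (\<tau> i) \<theta>) t + max 0 (t - (1 + \<tau> i)))"
        using True by (intro sum_mono) (auto simp: min_def max_def)
      finally show ?thesis .
    next
      case False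
      have "min (1 + min (\<tau> i) \<theta>) t = 1 + min (\<tau> i) \<theta>" for i using False by auto
      then have "(\<Sum>i\<in>UNIV. min (1 + min (\<tau> i) \<theta>) t + max 0 (t - (1 + \<tau> i)))
          = (d + 1 - \<sigma>) + (\<Sum>i\<in>UNIV. max 0 (t - (1 + \<tau> i)))"
        by (simp add: sum.distrib \<theta> d_def)
      moreover have "s0 * t \<le> (d + 1 - \<sigma>) + (\<Sum>i\<in>UNIV. max 0 (t - (1 + \<tau> i)))"
      proof (rule breakpoint_bound)
        show "s0 * (1 + \<tau> i) \<le> (d + 1 - \<sigma>) + (\<Sum>k\<in>UNIV. max 0 (1 + \<tau> i - (1 + \<tau> k)))" for i
          using s0[of i] by (simp add: d_def)
      qed (use s t d \<sigma> in \<open>auto simp: d_def\<close>)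
      ultimately show ?thesis by simp
    qed
    also have "\<dots> \<le> (\<Sum>i\<in>UNIV. min (1 + v i) t + max 0 (t - (1 + \<tau> i + \<eta>)) + 2 * \<eta>)"
      using \<eta>(1) by (intro sum_mono) (auto simp: v_def min_def max_def)
    also have "\<dots> = (\<Sum>i\<in>UNIV. min (1 + v i) t + max 0 (t - (1 + \<tau> i + \<eta>))) + 2 * d * \<eta>"
      by (simp add: sum.distrib d_def)
    finally have "s0 * t - 2 * d * \<eta> \<le> (\<Sum>i\<in>UNIV. min (1 + v i) t + max 0 (t - (1 + \<tau> i + \<eta>)))" by linarith
    moreover have "(s0 - s) * 1 \<le> (s0 - s) * t" using False s by (intro mult_left_mono) auto
    ultimately show ?thesis using \<eta>(3) by (simp add: algebra_simps)
  qed
  ultimately show ?thesis using \<eta> v by blast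
qed

section \<open>Rational points near the graph\<close>

text \<open>
  The fractional parts of \<open>q x\<^sub>i\<close> occur linearly in the second system, so two values
  of \<open>q\<close> in the same cell may still be subtracted.
\<close>

lemma dirichlet_dependent:
  fixes x v :: "'d::finite \<Rightarrow> real" and y w :: "'m::finite \<Rightarrow> real" and g :: "'m \<Rightarrow> 'd \<Rightarrow> real"
  assumes vw: "\<And>i. 0 \<le> v i" "\<And>j. 0 \<le> w j" "sum v UNIV + sum w UNIV < 1"
  shows "\<exists>Q0. \<forall>Q\<ge>Q0. \<exists>(q::nat) (p::'d \<Rightarrow> int) (p'::'m \<Rightarrow> int). 1 \<le> q \<and> q \<le> Q \<and>
    (\<forall>i. \<bar>real q * x i - p i\<bar> < real Q powr - v i) \<and>
    (\<forall>j. \<bar>real q * y j - (\<Sum>i\<in>UNIV. g j i * (real q * x i - p i)) - p' j\<bar> < real Q powr - w j)"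
proof -
  define u where "u k = (case k of Inl i \<Rightarrow> v i | Inr j \<Rightarrow> w j)" for k :: "'d + 'm"
  have u0: "0 \<le> u k" for k using vw by (auto simp: u_def split: sum.split)
  have usum: "sum u UNIV < 1"
    using vw(3) by (simp add: UNIV_Plus_UNIV[symmetric] sum.Plus u_def del: UNIV_Plus_UNIV)
  define n where "n = CARD('d + 'm)"
  \<comment> \<open>There will be at most \<open>2 ^ n * Q powr sum u UNIV\<close> cells, the powers
    of 2 coming from rounding up. As the exponent is below 1, this is eventually at most
    \<open>Q\<close>, fewer than the \<open>Q + 1\<close> values of \<open>q\<close>.\<close>
  have "((\<lambda>Q. 2 ^ n * real Q powr (sum u UNIV - 1)) \<longlongrightarrow> 2 ^ n * 0) sequentially"
    using usum by (intro tendsto_mult tendsto_const tendsto_neg_powr filterlim_real_sequentially) auto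
  then have "\<forall>\<^sub>F Q in sequentially. 2 ^ n * real Q powr (sum u UNIV - 1) < 1"
    by (rule order_tendstoD(2)) simp
  then obtain Q1 where Q1: "\<And>Q. Q1 \<le> Q \<Longrightarrow> 2 ^ n * real Q powr (sum u UNIV - 1) < 1"
    by (auto simp: eventually_sequentially)
  show ?thesis
  proof (rule exI[of _ "max 1 Q1"], intro allI impI)
    fix Q :: nat assume Q: "max 1 Q1 \<le> Q"
    define N where "N k = nat \<lceil>real Q powr u k\<rceil>" for k
    have one: "1 \<le> real Q powr u k" for k using Q u0 by (intro ge_one_powr_ge_zero) auto
    have N: "real Q powr u k \<le> real (N k)" "real (N k) \<le> 2 * real Q powr u k" "0 < N k" for k
      using one[of k] unfolding N_def by linarith+
    have "real (\<Prod>k\<in>UNIV. N k) \<le> (\<Prod>k\<in>UNIV. 2 * real Q powr u k)"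
      unfolding of_nat_prod using N by (intro prod_mono) auto
    also have "\<dots> = 2 ^ n * real Q powr sum u UNIV"
      using Q by (simp add: prod.distrib n_def powr_sum)
    also have "\<dots> = 2 ^ n * real Q powr (sum u UNIV - 1) * real Q"
      using Q by (simp add: powr_diff)
    also have "\<dots> \<le> 1 * real Q" using Q1[of Q] Q by (intro mult_right_mono) auto
    finally have card: "(\<Prod>k\<in>UNIV. N k) \<le> Q" unfolding mult_1 of_nat_le_iff .
    define F where "F q i = frac (real q * x i)" for q :: nat and i
    define \<Theta> where "\<Theta> q k = (case k of Inl i \<Rightarrow> real q * x i
        | Inr j \<Rightarrow> real q * y j - (\<Sum>i\<in>UNIV. g j i * F q i))" for q k
    define cell where "cell q = (\<lambda>k\<in>UNIV. nat \<lfloor>real (N k) * frac (\<Theta> q k)\<rfloor>)" for q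
    have "cell ` {0..Q} \<subseteq> (PiE UNIV (\<lambda>k. {..<N k}))"
    proof (clarsimp simp: cell_def)
      fix q k
      have "real (N k) * frac (\<Theta> q k) < real (N k) * 1"
        using N(3)[of k] frac_lt_1 by (intro mult_strict_left_mono) auto
      then show "nat \<lfloor>real (N k) * frac (\<Theta> q k)\<rfloor> < N k"
        using N(3)[of k] by (simp add: nat_less_iff floor_less_iff)
    qed
    then have "card (cell ` {0..Q}) \<le> card (PiE UNIV (\<lambda>k. {..<N k}))"
      by (intro card_mono finite_PiE) auto
    also have "\<dots> = (\<Prod>k\<in>UNIV. N k)" by (simp add: card_PiE)
    finally have "card (cell ` {0..Q}) < card {0..Q}" using card by simp
    then have "\<not> inj_on cell {0..Q}" by (rule pigeonhole)
    then obtain q1 q2 where "q1 \<in> {0..Q}" "q2 \<in> {0..Q}" "q1 < q2" "cell q1 = cell q2"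
      unfolding inj_on_def by (metis linorder_neqE_nat)
    then have q: "q1 < q2" "q2 \<le> Q" "cell q1 = cell q2" by auto
    have close: "\<bar>frac (\<Theta> q2 k) - frac (\<Theta> q1 k)\<bar> < real Q powr - u k" for k
    proof -
      have "nat \<lfloor>real (N k) * frac (\<Theta> q1 k)\<rfloor> = nat \<lfloor>real (N k) * frac (\<Theta> q2 k)\<rfloor>"
        using fun_cong[OF q(3), of k] by (simp add: cell_def)
      then have "\<lfloor>real (N k) * frac (\<Theta> q1 k)\<rfloor> = \<lfloor>real (N k) * frac (\<Theta> q2 k)\<rfloor>"
        by (simp add: eq_nat_nat_iff)
      then have "\<bar>real (N k) * frac (\<Theta> q2 k) - real (N k) * frac (\<Theta> q1 k)\<bar> < 1" by linarith
      then have "real (N k) * \<bar>frac (\<Theta> q2 k) - frac (\<Theta> q1 k)\<bar> < 1"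
        by (simp add: abs_mult flip: right_diff_distrib)
      then have "\<bar>frac (\<Theta> q2 k) - frac (\<Theta> q1 k)\<bar> < 1 / real (N k)"
        using N(3)[of k] by (simp add: field_simps)
      also have "\<dots> \<le> 1 / real Q powr u k" using N(1,3)[of k] one[of k] by (intro divide_left_mono mult_pos_pos) linarith+
      finally show ?thesis by (simp add: powr_minus_divide)
    qed
    \<comment> \<open>With differences of integer parts, \<open>q * x i - p i\<close> is exactly
      \<open>F q2 i - F q1 i\<close>, so the linear terms in \<open>\<Theta>\<close> subtract
      without remainder.\<close>
    define p where "p i = \<lfloor>real q2 * x i\<rfloor> - \<lfloor>real q1 * x i\<rfloor>" for i
    define p' where "p' j = \<lfloor>\<Theta> q2 (Inr j)\<rfloor> - \<lfloor>\<Theta> q1 (Inr j)\<rfloor>" for j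
    have diff: "real (q2 - q1) * x i - p i = F q2 i - F q1 i" for i
      using q(1) by (simp add: p_def F_def frac_def of_nat_diff algebra_simps)
    have "\<bar>real (q2 - q1) * x i - p i\<bar> < real Q powr - v i" for i
      unfolding diff using close[of "Inl i"] by (simp add: \<Theta>_def F_def u_def)
    moreover have "\<bar>real (q2 - q1) * y j - (\<Sum>i\<in>UNIV. g j i * (real (q2 - q1) * x i - p i)) - p' j\<bar> < real Q powr - w j" for j
    proof -
      have "real (q2 - q1) * y j - (\<Sum>i\<in>UNIV. g j i * (F q2 i - F q1 i)) - p' j = frac (\<Theta> q2 (Inr j)) - frac (\<Theta> q1 (Inr j))"
        using q(1) by (simp add: p'_def \<Theta>_def frac_def of_nat_diff algebra_simps sum_subtractf)
      then show ?thesis unfolding diff using close[of "Inr j"] by (simp add: u_def)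
    qed
    ultimately show "\<exists>(q::nat) (p::'d \<Rightarrow> int) (p'::'m \<Rightarrow> int). 1 \<le> q \<and> q \<le> Q \<and>
      (\<forall>i. \<bar>real q * x i - p i\<bar> < real Q powr - v i) \<and>
      (\<forall>j. \<bar>real q * y j - (\<Sum>i\<in>UNIV. g j i * (real q * x i - p i)) - p' j\<bar> < real Q powr - w j)"
      using q by (intro exI[of _ "q2 - q1"] exI[of _ p] exI[of _ p']) auto
  qed
qed

text \<open>Denominators up to \<open>M\<close> keep the irrational coordinate a fixed distance
  \<open>e\<close> away from the integers, so a large enough \<open>Q\<close> rules them out. Bounds
  in \<open>Q\<close> become bounds in \<open>q\<close> because \<open>q \<le> Q\<close> and the
  exponents are nonnegative.\<close>

lemma dirichlet_dependent_large:
  fixes x v :: "'d::finite \<Rightarrow> real" and y w :: "'m::finite \<Rightarrow> real" and g :: "'m \<Rightarrow> 'd \<Rightarrow> real"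
  assumes v: "\<And>i. 0 < v i" and w: "\<And>j. 0 \<le> w j" and vw: "sum v UNIV + sum w UNIV < 1" and irr: "x i0 \<notin> \<rat>"
  shows "\<exists>(q::nat) (p::'d \<Rightarrow> int) (p'::'m \<Rightarrow> int). M \<le> q \<and> 0 < q \<and>
    (\<forall>i. \<bar>real q * x i - p i\<bar> < real q powr - v i) \<and>
    (\<forall>j. \<bar>real q * y j - (\<Sum>i\<in>UNIV. g j i * (real q * x i - p i)) - p' j\<bar> < real q powr - w j)"
proof -
  \<comment> \<open>\<open>Suc M\<close> keeps the range nonempty when \<open>M = 0\<close>, so that
    the minimum is meaningful.\<close>
  define e where "e = Min ((\<lambda>q. \<bar>real q * x i0 - round (real q * x i0)\<bar>) ` {1..Suc M})"
  have "0 < \<bar>real q * x i0 - round (real q * x i0)\<bar>" if "q \<in> {1..Suc M}" for q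
  proof -
    have "real q * x i0 \<noteq> of_int (round (real q * x i0))"
    proof
      assume "real q * x i0 = of_int (round (real q * x i0))"
      then have "x i0 = of_int (round (real q * x i0)) / of_nat q" using that by (simp add: field_simps)
      then show False using irr by (metis Rats_divide Rats_of_int Rats_of_nat)
    qed
    then show ?thesis by simp
  qed
  then have e: "0 < e" by (simp add: e_def)
  have e_le: "e \<le> \<bar>real q * x i0 - of_int p\<bar>" if "q \<in> {1..Suc M}" for q p
  proof -
    have "e \<le> \<bar>real q * x i0 - round (real q * x i0)\<bar>" using that by (simp add: e_def)
    also have "\<dots> \<le> \<bar>real q * x i0 - of_int p\<bar>" by (rule round_diff_minimal)
    finally show ?thesis .
  qed
  have "((\<lambda>Q. real Q powr - v i0) \<longlongrightarrow> 0) sequentially"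
    using v by (intro tendsto_neg_powr filterlim_real_sequentially) auto
  then have "\<forall>\<^sub>F Q in sequentially. real Q powr - v i0 < e" using e by (intro order_tendstoD)
  then obtain Q1 where Q1: "\<And>Q. Q1 \<le> Q \<Longrightarrow> real Q powr - v i0 < e" by (auto simp: eventually_sequentially)
  obtain Q0 where Q0: "\<And>Q. Q0 \<le> Q \<Longrightarrow> \<exists>(q::nat) (p::'d \<Rightarrow> int) (p'::'m \<Rightarrow> int). 1 \<le> q \<and> q \<le> Q \<and>
    (\<forall>i. \<bar>real q * x i - p i\<bar> < real Q powr - v i) \<and>
    (\<forall>j. \<bar>real q * y j - (\<Sum>i\<in>UNIV. g j i * (real q * x i - p i)) - p' j\<bar> < real Q powr - w j)"
    using dirichlet_dependent[of v w x y g] v w vw by (auto simp: less_imp_le)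
  define Q where "Q = max Q0 Q1"
  have "Q0 \<le> Q" by (simp add: Q_def)
  from Q0[OF this] obtain q :: nat and p :: "'d \<Rightarrow> int" and p' :: "'m \<Rightarrow> int" where
    "1 \<le> q \<and> q \<le> Q \<and> (\<forall>i. \<bar>real q * x i - p i\<bar> < real Q powr - v i) \<and>
      (\<forall>j. \<bar>real q * y j - (\<Sum>i\<in>UNIV. g j i * (real q * x i - p i)) - p' j\<bar> < real Q powr - w j)"
    by (elim exE) (rule that)
  then have q: "1 \<le> q" "q \<le> Q" and p: "\<And>i. \<bar>real q * x i - p i\<bar> < real Q powr - v i"
    and p': "\<And>j. \<bar>real q * y j - (\<Sum>i\<in>UNIV. g j i * (real q * x i - p i)) - p' j\<bar> < real Q powr - w j"
    by auto
  have "M \<le> q"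
  proof (rule ccontr)
    assume "\<not> M \<le> q"
    then have "e \<le> \<bar>real q * x i0 - p i0\<bar>" using q by (intro e_le) auto
    then show False using p[of i0] Q1[of Q] by (simp add: Q_def)
  qed
  moreover have "real Q powr - v i \<le> real q powr - v i" "real Q powr - w j \<le> real q powr - w j" for i j
    using q v[of i] w[of j] by (auto intro!: powr_mono2')
  ultimately show ?thesis
    using q less_le_trans[OF p] less_le_trans[OF p']
    by (intro exI[of _ q] exI[of _ p] exI[of _ p'] conjI allI) auto
qed

section \<open>From local expansions to approximating boxes\<close>

text \<open>Continuity bounds both derivatives on a compact ball. The mean value inequality then
  makes \<open>f\<close> and \<open>f'\<close> Lipschitz there, and applied to \<open>f\<close>
  minus its linear part at \<open>x\<close> it yields the quadratic remainder.\<close>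

lemma C2_on_local_expansion:
  fixes f :: "'a::euclidean_space \<Rightarrow> 'b::real_normed_vector"
  assumes f: "C2_on U f" and U: "open U" "x0 \<in> U"
  shows "\<exists>\<rho> L K (f' :: 'a \<Rightarrow> 'a \<Rightarrow>\<^sub>L 'b). 0 < \<rho> \<and> 0 \<le> L \<and> 0 \<le> K \<and> cball x0 \<rho> \<subseteq> U \<and>
    (\<forall>x\<in>cball x0 \<rho>. \<forall>y\<in>cball x0 \<rho>. norm (f y - f x) \<le> L * norm (y - x) \<and>
       norm (f y - f x - f' x (y - x)) \<le> K * (norm (y - x))\<^sup>2)"
proof -
  obtain f' :: "'a \<Rightarrow> 'a \<Rightarrow>\<^sub>L 'b" and f'' :: "'a \<Rightarrow> 'a \<Rightarrow>\<^sub>L 'a \<Rightarrow>\<^sub>L 'b"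
    where f': "\<And>x. x \<in> U \<Longrightarrow> (f has_derivative blinfun_apply (f' x)) (at x)"
      and f'': "\<And>x. x \<in> U \<Longrightarrow> (f' has_derivative blinfun_apply (f'' x)) (at x)"
      and cont: "continuous_on U f''"
    using f unfolding C2_on_def by blast
  obtain \<rho> where \<rho>: "0 < \<rho>" "cball x0 \<rho> \<subseteq> U" using U open_contains_cball by blast
  let ?B = "cball x0 \<rho>"
  have "continuous_on ?B f''" using cont \<rho>(2) by (rule continuous_on_subset)
  moreover have "continuous_on ?B f'"
    using f'' \<rho>(2) by (intro continuous_at_imp_continuous_on ballI has_derivative_continuous) blast
  ultimately have "bounded (f'' ` ?B)" "bounded (f' ` ?B)"
    by (simp_all add: compact_continuous_image compact_imp_bounded)
  then obtain K L where K: "\<And>x. x \<in> ?B \<Longrightarrow> norm (f'' x) \<le> K" and L: "\<And>x. x \<in> ?B \<Longrightarrow> norm (f' x) \<le> L"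
    unfolding bounded_iff ball_simps by blast
  have "x0 \<in> ?B" using \<rho> by simp
  then have "0 \<le> K" "0 \<le> L" using K[of x0] L[of x0] norm_ge_zero[of "f'' x0"] norm_ge_zero[of "f' x0"] by linarith+
  have lip: "norm (f y - f x) \<le> L * norm (y - x)" if "x \<in> ?B" "y \<in> ?B" for x y
  proof (rule differentiable_bound[OF convex_cball[of x0 \<rho>] _ _ that(2,1)])
    fix z assume z: "z \<in> ?B"
    then have "z \<in> U" using \<rho>(2) by blast
    then show "(f has_derivative blinfun_apply (f' z)) (at z within ?B)"
      by (rule has_derivative_at_withinI[OF f'])
    show "onorm (blinfun_apply (f' z)) \<le> L" using L[OF z] by (simp add: norm_blinfun.rep_eq)
  qed
  have lip': "norm (f' y - f' x) \<le> K * norm (y - x)" if "x \<in> ?B" "y \<in> ?B" for x y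
  proof (rule differentiable_bound[OF convex_cball[of x0 \<rho>] _ _ that(2,1)])
    fix z assume z: "z \<in> ?B"
    then have "z \<in> U" using \<rho>(2) by blast
    then show "(f' has_derivative blinfun_apply (f'' z)) (at z within ?B)"
      by (rule has_derivative_at_withinI[OF f''])
    show "onorm (blinfun_apply (f'' z)) \<le> K" using K[OF z] by (simp add: norm_blinfun.rep_eq)
  qed
  have "norm (f y - f x - f' x (y - x)) \<le> K * (norm (y - x))\<^sup>2" if x: "x \<in> ?B" and y: "y \<in> ?B" for x y
  proof -
    \<comment> \<open>Restricting to points no farther from \<open>x\<close> than \<open>y\<close>
      bounds the derivative \<open>f' z - f' x\<close> by \<open>K * norm (y - x)\<close>.\<close>
    define S where "S = ?B \<inter> cball x (norm (y - x))"
    have "norm ((f y - f' x y) - (f x - f' x x)) \<le> (K * norm (y - x)) * norm (y - x)"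
    proof (rule differentiable_bound[where S = S and f' = "\<lambda>z. blinfun_apply (f' z - f' x)"])
      show "convex S" by (simp add: S_def convex_Int)
      fix z assume z: "z \<in> S"
      show "((\<lambda>z. f z - f' x z) has_derivative blinfun_apply (f' z - f' x)) (at z within S)"
      proof -
        have "z \<in> U" using z \<rho>(2) by (auto simp: S_def)
        then have "(f has_derivative blinfun_apply (f' z)) (at z within S)"
          by (rule has_derivative_at_withinI[OF f'])
        moreover have "(blinfun_apply (f' x) has_derivative blinfun_apply (f' x)) (at z within S)"
          by (rule bounded_linear_imp_has_derivative) (rule blinfun.bounded_linear_right)
        ultimately have "((\<lambda>z. f z - f' x z) has_derivative (\<lambda>h. f' z h - f' x h)) (at z within S)"
          by (rule has_derivative_diff)
        also have "(\<lambda>h. f' z h - f' x h) = blinfun_apply (f' z - f' x)"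
          by (simp add: fun_eq_iff blinfun.diff_left)
        finally show ?thesis .
      qed
      have "norm (f' z - f' x) \<le> K * norm (z - x)" using z x by (intro lip') (auto simp: S_def)
      also have "\<dots> \<le> K * norm (y - x)"
        using z \<open>0 \<le> K\<close> by (intro mult_left_mono) (auto simp: S_def dist_norm norm_minus_commute)
      finally show "onorm (blinfun_apply (f' z - f' x)) \<le> K * norm (y - x)" by (simp add: norm_blinfun.rep_eq)
    qed (use x y in \<open>auto simp: S_def dist_norm norm_minus_commute\<close>)
    then show ?thesis by (simp add: blinfun.diff_right power2_eq_square algebra_simps)
  qed
  with lip \<rho> \<open>0 \<le> K\<close> \<open>0 \<le> L\<close> show ?thesis by blast
qed

lemma sum_UNIV_Plus:
  fixes h :: "'a::finite + 'b::finite \<Rightarrow> 'c::comm_monoid_add"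
  shows "sum h UNIV = (\<Sum>i\<in>UNIV. h (Inl i)) + (\<Sum>j\<in>UNIV. h (Inr j))"
  by (simp add: UNIV_Plus_UNIV[symmetric] sum.Plus del: UNIV_Plus_UNIV)

lemma dist_Inl_projection_le:
  fixes x y :: "real ^ ('d::finite + 'm::finite)"
  shows "dist (\<chi> i. x $ Inl i :: real ^ 'd) (\<chi> i. y $ Inl i) \<le> dist x y"
  unfolding dist_vec_def L2_set_def sum_UNIV_Plus by (simp add: sum_nonneg)

text \<open>Dirichlet's theorem is used with \<open>g\<close> the partial derivatives of
  \<open>f\<close> at \<open>x\<close>. With \<open>z = p/q\<close> it then says that the
  linearisation of \<open>f\<close> at \<open>x\<close>, evaluated at \<open>z\<close>, is close to
  \<open>p'/q\<close>. Taylor's bound passes to \<open>f z\<close>, and the Lipschitz bound passes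
  from \<open>z\<close> to every \<open>u\<close> in the short box.\<close>

lemma approximating_boxes:
  fixes f :: "real ^ 'd::finite \<Rightarrow> real ^ 'm::finite" and f' :: "real ^ 'd \<Rightarrow> (real ^ 'd) \<Rightarrow>\<^sub>L (real ^ 'm)"
    and \<tau> :: "real ^ ('d + 'm)" and v :: "'d \<Rightarrow> real"
  assumes lip: "\<And>x y. x \<in> cball x0 \<rho> \<Longrightarrow> y \<in> cball x0 \<rho> \<Longrightarrow> norm (f y - f x) \<le> L * norm (y - x)"
    and taylor: "\<And>x y. x \<in> cball x0 \<rho> \<Longrightarrow> y \<in> cball x0 \<rho> \<Longrightarrow>
        norm (f y - f x - f' x (y - x)) \<le> K * (norm (y - x))\<^sup>2"
    and pos: "0 \<le> L" "0 \<le> K" "0 < \<rho>" "0 < \<eta>"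
    and v: "\<And>i. 0 < v i" and \<tau>: "\<And>k. 0 < \<tau> $ k" "\<And>i j. \<tau> $ Inr j \<le> \<tau> $ Inl i"
    and vsum: "sum v UNIV + (\<Sum>j\<in>UNIV. \<tau> $ Inr j) + \<eta> \<le> 1"
    and x: "x \<in> ball x0 (\<rho> / 2)" "x $ l \<notin> \<rat>"
  shows "\<exists>c (q::nat). 0 < q \<and> snd c = real q \<and> Q \<le> real q \<and> x \<in> scaled_box (\<lambda>i. 1 + v i) c \<and>
    (\<forall>u\<in>scaled_cbox (\<lambda>i. 1 + \<tau> $ Inl i + \<eta>) c. u \<in> cball x0 \<rho> \<and>
      (\<exists>p :: int ^ ('d + 'm). \<forall>k. \<bar>real q * vec_append u (f u) $ k - real_of_int (p $ k)\<bar> < real q powr - (\<tau> $ k)))"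
proof -
  define d where "d = real CARD('d)"
  have d: "1 \<le> d" unfolding d_def by (simp add: Suc_leI)
  \<comment> \<open>Half of the reserve \<open>\<eta>\<close> is shared among the dependent
    coordinates; the other half keeps the total of the exponents strictly below 1.\<close>
  define \<epsilon> where "\<epsilon> = \<eta> / (2 * real CARD('m))"
  have \<epsilon>: "0 < \<epsilon>" "(\<Sum>j\<in>(UNIV::'m set). \<epsilon>) = \<eta> / 2" using pos by (simp_all add: \<epsilon>_def)
  define w where "w j = \<tau> $ Inr j + \<epsilon>" for j
  have w: "0 \<le> w j" for j using \<tau>(1)[of "Inr j"] \<epsilon> by (simp add: w_def)
  have vw: "sum v UNIV + sum w UNIV < 1"
    using vsum pos \<epsilon>(2) by (simp add: w_def sum.distrib)
  have \<tau>1: "\<tau> $ Inr j < 1" for j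
  proof -
    have "\<tau> $ Inr j \<le> (\<Sum>j\<in>UNIV. \<tau> $ Inr j)"
      using \<tau>(1) by (intro member_le_sum) (auto simp: less_imp_le)
    moreover have "0 \<le> sum v UNIV" using v by (intro sum_nonneg) (simp add: less_imp_le)
    ultimately show ?thesis using vsum pos by linarith
  qed
  \<comment> \<open>The Dirichlet, Taylor and Lipschitz errors, each divided by the allowed
    \<open>q powr - \<tau> $ Inr j\<close>. They tend to 0 because of \<open>\<epsilon> > 0\<close>,
    \<open>\<tau> $ Inr j < 1\<close> and \<open>\<eta> > 0\<close> respectively.\<close>
  define err where "err j q = real q powr - \<epsilon> + K * d\<^sup>2 * real q powr (\<tau> $ Inr j - 1) + L * d * real q powr - \<eta>" for j q
  have "(err j \<longlongrightarrow> 0 + K * d\<^sup>2 * 0 + L * d * 0) sequentially" for j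
    unfolding err_def using \<epsilon> pos \<tau>1[of j]
    by (intro tendsto_add tendsto_mult tendsto_const tendsto_neg_powr filterlim_real_sequentially) auto
  then have "\<forall>\<^sub>F q in sequentially. err j q < 1" for j
    by (intro order_tendstoD(2)) auto
  then have "\<forall>\<^sub>F q in sequentially. \<forall>j. err j q < 1" by (simp add: eventually_all_finite)
  \<comment> \<open>The bound \<open>4 * d / \<rho>\<close> makes the steps from \<open>x\<close> to
    \<open>z\<close> and from \<open>z\<close> to \<open>u\<close> at most \<open>\<rho> / 4\<close>
    each, so both points stay in the ball around \<open>x0\<close>.\<close>
  moreover have "\<forall>\<^sub>F q in sequentially. max 2 (max Q (4 * d / \<rho>)) \<le> real q"
    using filterlim_real_sequentially unfolding filterlim_at_top by blast
  ultimately have "\<forall>\<^sub>F q in sequentially. (\<forall>j. err j q < 1) \<and> max 2 (max Q (4 * d / \<rho>)) \<le> real q"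
    by (rule eventually_conj)
  then obtain M where M: "\<And>q. M \<le> q \<Longrightarrow> (\<forall>j. err j q < 1) \<and> max 2 (max Q (4 * d / \<rho>)) \<le> real q"
    unfolding eventually_sequentially by blast
  define g where "g j i = f' x (axis i 1) $ j" for j i
  obtain q :: nat and p :: "'d \<Rightarrow> int" and p' :: "'m \<Rightarrow> int" where "M \<le> q \<and> 0 < q \<and>
      (\<forall>i. \<bar>real q * x $ i - p i\<bar> < real q powr - v i) \<and>
      (\<forall>j. \<bar>real q * f x $ j - (\<Sum>i\<in>UNIV. g j i * (real q * x $ i - p i)) - p' j\<bar> < real q powr - w j)"
    using dirichlet_dependent_large[of v w "\<lambda>i. x $ i" l M "\<lambda>j. f x $ j" g, OF v w vw x(2)]
    by (elim exE) (rule that)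
  then have "M \<le> q" "0 < q" and p: "\<And>i. \<bar>real q * x $ i - p i\<bar> < real q powr - v i"
    and p': "\<And>j. \<bar>real q * f x $ j - (\<Sum>i\<in>UNIV. g j i * (real q * x $ i - p i)) - p' j\<bar> < real q powr - w j"
    by auto
  have err: "err j q < 1" and q: "2 \<le> real q" "Q \<le> real q" "4 * d / \<rho> \<le> real q" for j
    using M[OF \<open>M \<le> q\<close>] by auto
  have dq: "d / q \<le> \<rho> / 4" using q(1,3) pos by (simp add: field_simps)
  define z :: "real ^ 'd" where "z = (\<chi> i. p i / q)"
  have xz: "\<bar>x $ i - z $ i\<bar> < real q powr - (1 + v i)" for i
  proof -
    have "x $ i - z $ i = (real q * x $ i - p i) / q"
      using q by (simp add: z_def field_simps)
    then have "\<bar>x $ i - z $ i\<bar> = \<bar>real q * x $ i - p i\<bar> / q" by simp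
    also have "\<dots> < real q powr - v i / q" using p[of i] q by (intro divide_strict_right_mono) auto
    also have "\<dots> = real q powr - (1 + v i)"
      using q by (simp add: powr_diff powr_minus_divide)
    finally show ?thesis .
  qed
  have nzx: "norm (z - x) \<le> d / q"
  proof -
    have "\<bar>(z - x) $ i\<bar> \<le> 1 / q" for i
    proof -
      have "real q powr - (1 + v i) \<le> real q powr - 1" using q v[of i] by (intro powr_mono) auto
      then show ?thesis using xz[of i] q by (simp add: powr_minus_divide abs_minus_commute)
    qed
    then have "norm (z - x) \<le> (\<Sum>i\<in>(UNIV::'d set). 1 / q)"
      by (intro order_trans[OF norm_le_l1_cart] sum_mono)
    then show ?thesis by (simp add: d_def)
  qed
  have xin: "x \<in> cball x0 \<rho>" using x pos by auto
  have zin: "dist x0 z \<le> 3 / 4 * \<rho>"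
  proof -
    have "dist x0 z \<le> dist x0 x + norm (z - x)"
      using dist_triangle[of x0 z x] by (simp add: dist_norm norm_minus_commute)
    moreover have "dist x0 x < \<rho> / 2" using x(1) by (simp only: mem_ball)
    ultimately show ?thesis using nzx dq by linarith
  qed
  have deriv: "real q * (f' x (z - x) $ j) = - (\<Sum>i\<in>UNIV. g j i * (real q * x $ i - p i))" for j
  proof -
    have "f' x (z - x) = (\<Sum>i\<in>UNIV. (z - x) $ i *\<^sub>R f' x (axis i 1))"
      by (subst basis_expansion[of "z - x", symmetric])
        (simp only: scalar_mult_eq_scaleR blinfun.sum_right blinfun.scaleR_right)
    then have "real q * (f' x (z - x) $ j) = (\<Sum>i\<in>UNIV. real q * ((z - x) $ i * g j i))"
      by (simp add: g_def sum_distrib_left)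
    also have "\<dots> = (\<Sum>i\<in>UNIV. - (g j i * (real q * x $ i - p i)))"
      using q by (intro sum.cong) (auto simp: z_def field_simps)
    finally show ?thesis by (simp add: sum_negf)
  qed
  have "u \<in> cball x0 \<rho> \<and>
      (\<exists>P :: int ^ ('d + 'm). \<forall>k. \<bar>real q * vec_append u (f u) $ k - real_of_int (P $ k)\<bar> < real q powr - (\<tau> $ k))"
    if "u \<in> scaled_cbox (\<lambda>i. 1 + \<tau> $ Inl i + \<eta>) (z, real q)" for u
  proof -
    have uz: "\<bar>u $ i - z $ i\<bar> \<le> real q powr - (1 + \<tau> $ Inl i + \<eta>)" for i
      using that by (simp add: mem_scaled_cbox)
    \<comment> \<open>Needed for two values of \<open>e\<close>: with 1 it keeps \<open>u\<close> in
      the ball, and with \<open>1 + \<tau> $ Inr j + \<eta>\<close> it controls the Lipschitz error.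
      The second is where the dependent exponents must not exceed the independent ones.\<close>
    have nuz: "norm (u - z) \<le> d * real q powr - e" if "\<And>i. e \<le> 1 + \<tau> $ Inl i + \<eta>" for e
    proof -
      have "\<bar>(u - z) $ i\<bar> \<le> real q powr - e" for i
      proof -
        have "real q powr - (1 + \<tau> $ Inl i + \<eta>) \<le> real q powr - e"
          using q that[of i] by (intro powr_mono) auto
        then show ?thesis using uz[of i] by simp
      qed
      then have "norm (u - z) \<le> (\<Sum>i\<in>(UNIV::'d set). real q powr - e)"
        by (intro order_trans[OF norm_le_l1_cart] sum_mono)
      then show ?thesis by (simp add: d_def)
    qed
    have "1 \<le> 1 + \<tau> $ Inl i + \<eta>" for i using \<tau>(1)[of "Inl i"] pos by simp
    then have "norm (u - z) \<le> d * real q powr - 1" by (rule nuz)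
    then have "norm (u - z) \<le> d / q" using q by (simp add: powr_minus_divide)
    then have uin: "u \<in> cball x0 \<rho>"
    proof -
      have "dist x0 u \<le> dist x0 z + norm (u - z)"
        using dist_triangle[of x0 u z] by (simp add: dist_norm norm_minus_commute)
      then show ?thesis using zin dq \<open>norm (u - z) \<le> d / q\<close> unfolding mem_cball by linarith
    qed
    have zin': "z \<in> cball x0 \<rho>" using zin pos by simp
    have left: "\<bar>real q * u $ i - p i\<bar> < real q powr - (\<tau> $ Inl i)" for i
    proof -
      have "real q * u $ i - p i = real q * (u $ i - z $ i)"
        using q by (simp add: z_def field_simps)
      then have "\<bar>real q * u $ i - p i\<bar> = real q * \<bar>u $ i - z $ i\<bar>" by (simp add: abs_mult)
      also have "\<dots> \<le> real q powr 1 * real q powr - (1 + \<tau> $ Inl i + \<eta>)"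
        using uz[of i] q by (simp add: mult_left_mono)
      also have "\<dots> = real q powr (- (\<tau> $ Inl i) - \<eta>)" unfolding powr_add[symmetric] by simp
      also have "\<dots> < real q powr - (\<tau> $ Inl i)" using q pos by (intro powr_less_mono) auto
      finally show ?thesis .
    qed
    have right: "\<bar>real q * f u $ j - p' j\<bar> < real q powr - (\<tau> $ Inr j)" for j
    proof -
      let ?t = "\<tau> $ Inr j"
      have "\<bar>(f z - f x - f' x (z - x)) $ j\<bar> \<le> K * (d / q)\<^sup>2"
      proof -
        have "\<bar>(f z - f x - f' x (z - x)) $ j\<bar> \<le> K * (norm (z - x))\<^sup>2"
          using component_le_norm_cart taylor[OF xin zin'] by (rule order_trans)
        also have "\<dots> \<le> K * (d / q)\<^sup>2" using nzx pos by (intro mult_left_mono power_mono) auto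
        finally show ?thesis .
      qed
      then have "real q * \<bar>(f z - f x - f' x (z - x)) $ j\<bar> \<le> real q * (K * (d / q)\<^sup>2)"
        by (rule mult_left_mono) simp
      also have "real q * (K * (d / q)\<^sup>2) = K * d\<^sup>2 * real q powr - 1"
        using q by (simp add: powr_minus_divide power2_eq_square)
      finally have B: "real q * \<bar>(f z - f x - f' x (z - x)) $ j\<bar> \<le> K * d\<^sup>2 * real q powr - 1" .
      have "\<bar>(f u - f z) $ j\<bar> \<le> L * (d * real q powr - (1 + ?t + \<eta>))"
      proof -
        have "\<bar>(f u - f z) $ j\<bar> \<le> L * norm (u - z)"
          using component_le_norm_cart lip[OF zin' uin] by (rule order_trans)
        also have "\<dots> \<le> L * (d * real q powr - (1 + ?t + \<eta>))"
          using \<tau>(2) pos by (intro mult_left_mono nuz) auto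
        finally show ?thesis .
      qed
      then have "real q * \<bar>(f u - f z) $ j\<bar> \<le> real q * (L * (d * real q powr - (1 + ?t + \<eta>)))"
        by (rule mult_left_mono) simp
      also have "\<dots> = L * d * (real q powr 1 * real q powr - (1 + ?t + \<eta>))" using q by simp
      also have "\<dots> = L * d * real q powr (- ?t - \<eta>)" unfolding powr_add[symmetric] by simp
      finally have C: "real q * \<bar>(f u - f z) $ j\<bar> \<le> L * d * real q powr (- ?t - \<eta>)" .
      have split: "real q * f u $ j - p' j
          = (real q * f x $ j - (\<Sum>i\<in>UNIV. g j i * (real q * x $ i - p i)) - p' j)
            + real q * (f z - f x - f' x (z - x)) $ j + real q * (f u - f z) $ j"
        using deriv[of j] by (simp add: algebra_simps)
      have "\<bar>real q * f u $ j - p' j\<bar>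
          \<le> \<bar>real q * f x $ j - (\<Sum>i\<in>UNIV. g j i * (real q * x $ i - p i)) - p' j\<bar>
            + real q * \<bar>(f z - f x - f' x (z - x)) $ j\<bar> + real q * \<bar>(f u - f z) $ j\<bar>"
      proof -
        have "\<bar>A + real q * B + real q * C\<bar> \<le> \<bar>A\<bar> + real q * \<bar>B\<bar> + real q * \<bar>C\<bar>" for A B C
          using abs_triangle_ineq[of "A + real q * B" "real q * C"] abs_triangle_ineq[of A "real q * B"]
          by (simp add: abs_mult)
        then show ?thesis unfolding split .
      qed
      also have "\<dots> < real q powr - w j + K * d\<^sup>2 * real q powr - 1 + L * d * real q powr (- ?t - \<eta>)"
        using p'[of j] B C by linarith
      also have "\<dots> = real q powr - ?t * err j q"
      proof -
        have "real q powr - ?t * real q powr - \<epsilon> = real q powr - w j"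
          "real q powr - ?t * real q powr (?t - 1) = real q powr - 1"
          "real q powr - ?t * real q powr - \<eta> = real q powr (- ?t - \<eta>)"
          by (simp_all add: w_def flip: powr_add)
        then show ?thesis by (simp add: err_def distrib_left mult.left_commute)
      qed
      also have "\<dots> < real q powr - ?t * 1"
        using err q by (intro mult_strict_left_mono) auto
      finally show ?thesis by simp
    qed
    have "\<bar>real q * vec_append u (f u) $ k - real_of_int ((\<chi> k. case k of Inl i \<Rightarrow> p i | Inr j \<Rightarrow> p' j) $ k)\<bar>
        < real q powr - (\<tau> $ k)" for k
      using left right by (simp add: vec_append_def split: sum.split)
    with uin show ?thesis by blast
  qed
  then show ?thesis
    using xz \<open>0 < q\<close> q(2) by (intro exI[of _ "(z, real q)"] exI[of _ q]) (simp add: mem_scaled_box)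
qed

section \<open>The exponents of the statement and the conclusion\<close>

text \<open>By monotonicity the positive part vanishes before index \<open>i\<close> and is the
  plain difference from there on. This removes the order of the indices and gives the form required
  by \<open>exponents_exist\<close>.\<close>

lemma sum_indices_from:
  fixes \<tau> :: "real ^ ('d::{finite,linorder} + 'm::finite)"
  assumes "\<forall>i i'. i \<le> i' \<longrightarrow> \<tau> $ Inl i \<ge> \<tau> $ Inl i'"
  shows "(\<Sum>k\<in>indices_from i. \<tau> $ Inl i - \<tau> $ k) =
    (\<Sum>k\<in>UNIV. max 0 (\<tau> $ Inl i - \<tau> $ Inl k)) + real CARD('m) * \<tau> $ Inl i - (\<Sum>j\<in>UNIV. \<tau> $ Inr j)"
proof -
  have "(\<Sum>k\<in>indices_from i. \<tau> $ Inl i - \<tau> $ k) =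
      (\<Sum>k\<in>Inl ` {i..}. \<tau> $ Inl i - \<tau> $ k) + (\<Sum>k\<in>range Inr. \<tau> $ Inl i - \<tau> $ k)"
    unfolding indices_from_def by (rule sum.union_disjoint) auto
  also have "(\<Sum>k\<in>range Inr. \<tau> $ Inl i - \<tau> $ k) = real CARD('m) * \<tau> $ Inl i - (\<Sum>j\<in>UNIV. \<tau> $ Inr j)"
    by (simp add: sum.reindex sum_subtractf card_image)
  also have "(\<Sum>k\<in>Inl ` {i..}. \<tau> $ Inl i - \<tau> $ k) = (\<Sum>k\<in>{i..}. max 0 (\<tau> $ Inl i - \<tau> $ Inl k))"
    using assms by (subst sum.reindex) (auto intro!: sum.cong simp: max_def)
  also have "\<dots> = (\<Sum>k\<in>UNIV. max 0 (\<tau> $ Inl i - \<tau> $ Inl k))"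
    using assms by (intro sum.mono_neutral_left) (auto simp: max_def intro: antisym)
  finally show ?thesis by simp
qed

text \<open>A countable union of hyperplanes. It is the exceptional set of the mass transference:
  outside it, Dirichlet's denominators can be taken arbitrarily large.\<close>

lemma null_sets_rational_coordinate: "{x :: real ^ 'd::finite. x $ i \<in> \<rat>} \<in> null_sets lebesgue"
proof -
  have "{x :: real ^ 'd. x $ i \<in> \<rat>} = (\<Union>r\<in>\<rat>. {x. x $ i = r})" by auto
  moreover have "negligible (\<Union>r\<in>\<rat>. {x :: real ^ 'd. x $ i = r})"
    by (intro negligible_countable_Union countable_image countable_rat)
      (use negligible_standard_hyperplane[of "axis i (1::real)"] in \<open>auto simp: inner_axis\<close>)
  ultimately show ?thesis by (simp add: negligible_iff_null_sets)
qed

text \<open>Two hypotheses go beyond the English statement. The empty graph is excluded, since its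
  \<open>hausdorff_dim\<close> is 0 while the right-hand side is positive. The total of the
  exponents is at least 1: if it is smaller and the first \<open>d\<close> exponents coincide, the
  right-hand side exceeds \<open>d\<close>, the dimension of the graph.\<close>

theorem theorem1:
  fixes U :: "(real ^ 'd::{finite,linorder}) set"
    and f :: "real ^ 'd::{finite,linorder} \<Rightarrow> real ^ 'm::finite"
    and \<tau> :: "real ^ ('d::{finite,linorder} + 'm::finite)"
  assumes "open U" and "U \<noteq> {}"
    and "C2_on U f"
    and "\<forall>k. 0 < \<tau> $ k"
    and "\<forall>i i'. i \<le> i' \<longrightarrow> \<tau> $ Inl i \<ge> \<tau> $ Inl i'"
    and "\<tau> $ Inl (Max UNIV) \<ge> (MAX j. \<tau> $ Inr j)"
    and "(\<Sum>j\<in>UNIV. \<tau> $ Inr j) < 1"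
    and "(\<Sum>k\<in>UNIV. \<tau> $ k) \<ge> 1"
  shows "hausdorff_dim (weighted_approximable \<tau> \<inter> graph_on U f) \<ge>
    ereal (MIN i. (real CARD('d + 'm) + 1 + (\<Sum>k\<in>indices_from i. \<tau> $ Inl i - \<tau> $ k))
                     / (\<tau> $ Inl i + 1) - real CARD('m))"
proof -
  define \<phi> where "\<phi> i = (real CARD('d + 'm) + 1 + (\<Sum>k\<in>indices_from i. \<tau> $ Inl i - \<tau> $ k))
      / (\<tau> $ Inl i + 1) - real CARD('m)" for i
  define s0 where "s0 = (MIN i. \<phi> i)"
  define \<sigma> where "\<sigma> = (\<Sum>j\<in>UNIV. \<tau> $ Inr j)"
  define X where "X = weighted_approximable \<tau> \<inter> graph_on U f"
  define \<pi> where "\<pi> y = (\<chi> i. y $ Inl i)" for y :: "real ^ ('d + 'm)"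
  have \<tau>pos: "0 < \<tau> $ k" for k using assms(4) by blast
  have \<tau>le: "\<tau> $ Inr j \<le> \<tau> $ Inl i" for i j
  proof -
    have "\<tau> $ Inr j \<le> (MAX j. \<tau> $ Inr j)" by (intro Max_ge) auto
    also have "\<dots> \<le> \<tau> $ Inl (Max UNIV)" by (rule assms(6))
    also have "\<dots> \<le> \<tau> $ Inl i" using assms(5) by (simp add: Max_ge)
    finally show ?thesis .
  qed
  \<comment> \<open>Clearing the denominator \<open>1 + \<tau> $ Inl i\<close> cancels the
    contributions of \<open>CARD('m)\<close> and leaves the breakpoint form.\<close>
  have s0: "s0 * (1 + \<tau> $ Inl i) \<le> CARD('d) + 1 - \<sigma> + (\<Sum>k\<in>UNIV. max 0 (\<tau> $ Inl i - \<tau> $ Inl k))" for i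
  proof -
    have "s0 + CARD('m) \<le> (real CARD('d + 'm) + 1 + (\<Sum>k\<in>indices_from i. \<tau> $ Inl i - \<tau> $ k)) / (\<tau> $ Inl i + 1)"
    proof -
      have "s0 \<le> \<phi> i" unfolding s0_def by (intro Min_le) auto
      then show ?thesis unfolding \<phi>_def by linarith
    qed
    then have "(s0 + CARD('m)) * (\<tau> $ Inl i + 1) \<le> real CARD('d + 'm) + 1 + (\<Sum>k\<in>indices_from i. \<tau> $ Inl i - \<tau> $ k)"
      using \<tau>pos[of "Inl i"] by (subst (asm) pos_le_divide_eq) auto
    then show ?thesis
      unfolding sum_indices_from[OF assms(5)] \<sigma>_def by (simp add: algebra_simps)
  qed
  have total: "1 \<le> (\<Sum>i\<in>UNIV. \<tau> $ Inl i) + \<sigma>"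
    using assms(8) by (simp add: sum_UNIV_Plus \<sigma>_def)
  \<comment> \<open>At the largest of the first \<open>d\<close> exponents the positive parts are
    plain differences, and the bound becomes \<open>CARD('d) * (1 + \<tau> $ Inl i)\<close> plus 1
    minus the total of all exponents.\<close>
  have s0_le: "s0 \<le> CARD('d)"
  proof -
    define i where "i = (Min UNIV :: 'd)"
    have "max 0 (\<tau> $ Inl i - \<tau> $ Inl k) = \<tau> $ Inl i - \<tau> $ Inl k" for k
      using assms(5) by (simp add: i_def max_def)
    then have "(\<Sum>k\<in>UNIV. max 0 (\<tau> $ Inl i - \<tau> $ Inl k)) = CARD('d) * \<tau> $ Inl i - (\<Sum>k\<in>UNIV. \<tau> $ Inl k)"
      by (simp only: sum_subtractf) simp
    then have "s0 * (1 + \<tau> $ Inl i) \<le> CARD('d) * (1 + \<tau> $ Inl i)"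
      using s0[of i] total by (simp add: algebra_simps)
    then show ?thesis using \<tau>pos[of "Inl i"] by (simp add: mult_le_cancel_right)
  qed
  have measure_pos: "hausdorff_measure s X \<noteq> 0" if s: "0 \<le> s" "s < s0" for s
  proof -
    obtain x0 where "x0 \<in> U" using assms(2) by blast
    then obtain \<rho> L K and f' :: "real ^ 'd::{finite,linorder} \<Rightarrow> (real ^ 'd::{finite,linorder}) \<Rightarrow>\<^sub>L (real ^ 'm)" where
      \<rho>: "0 < \<rho>" "0 \<le> L" "0 \<le> K" "cball x0 \<rho> \<subseteq> U"
      and ex: "\<forall>x\<in>cball x0 \<rho>. \<forall>y\<in>cball x0 \<rho>. norm (f y - f x) \<le> L * norm (y - x) \<and>
         norm (f y - f x - f' x (y - x)) \<le> K * (norm (y - x))\<^sup>2"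
      using C2_on_local_expansion[OF assms(3,1)] by blast
    \<comment> \<open>An intermediate exponent: one gap is spent on perturbing the exponents, the
      other on the densities in the mass transference.\<close>
    define s1 where "s1 = (s + s0) / 2"
    have s1: "s < s1" "s1 < s0" using s by (auto simp: s1_def)
    obtain v \<eta> where \<eta>: "0 < \<eta>" and v: "\<And>i. 0 < v i" "\<And>i. v i \<le> \<tau> $ Inl i"
      and vsum: "sum v UNIV + \<sigma> + \<eta> \<le> 1"
      and mass: "\<And>t. 0 \<le> t \<Longrightarrow> s1 * t \<le> (\<Sum>i\<in>UNIV. min (1 + v i) t + max 0 (t - (1 + \<tau> $ Inl i + \<eta>)))"
      using exponents_exist[of "\<lambda>i. \<tau> $ Inl i" \<sigma> s0 s1, OF \<tau>pos _ total s0 s1(2) s0_le] assms(7)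
      unfolding \<sigma>_def by blast
    \<comment> \<open>The admissible boxes: every point of the short box is approximable with the
      denominator \<open>q\<close> of that box.\<close>
    define G where "G = {c. \<exists>q::nat. 0 < q \<and> snd c = real q \<and>
      (\<forall>u\<in>scaled_cbox (\<lambda>i. 1 + \<tau> $ Inl i + \<eta>) c. u \<in> cball x0 \<rho> \<and>
        (\<exists>p :: int ^ ('d + 'm). \<forall>k. \<bar>real q * vec_append u (f u) $ k - real_of_int (p $ k)\<bar> < real q powr - (\<tau> $ k)))}"
    \<comment> \<open>Any coordinate will do; one irrational coordinate already forces large
      denominators.\<close>
    define i0 :: 'd where "i0 = undefined"
    interpret box_transfer "\<lambda>i. 1 + v i" "\<lambda>i. 1 + \<tau> $ Inl i + \<eta>" G "ball x0 (\<rho> / 2)" "{x. x $ i0 \<in> \<rat>}" s1 s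
    proof
      show "1 + v i < 1 + \<tau> $ Inl i + \<eta>" for i using v(2)[of i] \<eta> by linarith
      show "0 < 1 + v i" for i using v(1)[of i] by linarith
      show "\<exists>c\<in>G. Q \<le> snd c \<and> x \<in> scaled_box (\<lambda>i. 1 + v i) c"
        if "x \<in> ball x0 (\<rho> / 2) - {x. x $ i0 \<in> \<rat>}" for x Q
      proof -
        have "\<exists>c (q::nat). 0 < q \<and> snd c = real q \<and> Q \<le> real q \<and> x \<in> scaled_box (\<lambda>i. 1 + v i) c \<and>
          (\<forall>u\<in>scaled_cbox (\<lambda>i. 1 + \<tau> $ Inl i + \<eta>) c. u \<in> cball x0 \<rho> \<and>
            (\<exists>p :: int ^ ('d + 'm). \<forall>k. \<bar>real q * vec_append u (f u) $ k - real_of_int (p $ k)\<bar> < real q powr - (\<tau> $ k)))"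
          by (rule approximating_boxes[where L = L and K = K and f' = f' and l = i0])
            (use ex \<rho> \<eta> v \<tau>pos \<tau>le vsum that in \<open>auto simp: \<sigma>_def\<close>)
        then show ?thesis unfolding G_def by force
      qed
    qed (use s s1 \<rho> mass null_sets_rational_coordinate in auto)
    have "hausdorff_measure s (\<pi> ` X) \<noteq> 0"
    proof (rule limsup_hausdorff_measure_pos, rule subsetI)
      fix x assume "x \<in> {x \<in> ball x0 (\<rho> / 2). \<forall>Q. \<exists>c\<in>G. Q \<le> snd c \<and> x \<in> scaled_cbox (\<lambda>i. 1 + \<tau> $ Inl i + \<eta>) c}"
      then have x: "x \<in> ball x0 (\<rho> / 2)"
        and approx: "\<And>Q. \<exists>c\<in>G. Q \<le> snd c \<and> x \<in> scaled_cbox (\<lambda>i. 1 + \<tau> $ Inl i + \<eta>) c" by auto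
      define y where "y = vec_append x (f x)"
      let ?S = "{(p :: int ^ ('d + 'm), q :: nat). 0 < q \<and> (\<forall>k. \<bar>real q * y $ k - real_of_int (p $ k)\<bar> < real q powr - (\<tau> $ k))}"
      \<comment> \<open>A finite set of solutions would bound \<open>q\<close>, whereas the short
        boxes containing \<open>x\<close> have arbitrarily large denominators.\<close>
      have "infinite ?S"
      proof
        assume "finite ?S"
        then have "finite (snd ` ?S)" by (rule finite_imageI)
        then obtain M where M: "\<And>q. q \<in> snd ` ?S \<Longrightarrow> q \<le> M" by (meson finite_nat_set_iff_bounded_le)
        obtain c where c: "c \<in> G" "real (Suc M) \<le> snd c" "x \<in> scaled_cbox (\<lambda>i. 1 + \<tau> $ Inl i + \<eta>) c"
          using approx by blast
        then obtain q :: nat and p :: "int ^ ('d + 'm)" where q: "0 < q" "snd c = real q"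
          and p: "\<forall>k. \<bar>real q * y $ k - real_of_int (p $ k)\<bar> < real q powr - (\<tau> $ k)"
          unfolding G_def y_def by blast
        have "(p, q) \<in> ?S" using q p by simp
        from imageI[OF this, of snd] have "q \<in> snd ` ?S" by (simp only: snd_conv)
        then show False using M[of q] q c by simp
      qed
      moreover have "x \<in> U" using x \<rho> by (auto simp: subset_iff)
      ultimately have "y \<in> X" by (auto simp: X_def weighted_approximable_def graph_on_def y_def)
      moreover have "\<pi> y = x" by (simp add: \<pi>_def y_def vec_append_def vec_eq_iff)
      ultimately show "x \<in> \<pi> ` X" by blast
    qed
    moreover have "hausdorff_measure s (\<pi> ` X) \<le> hausdorff_measure s X"
      unfolding \<pi>_def using s(1) by (intro hausdorff_measure_image_le dist_Inl_projection_le)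
    ultimately show ?thesis by auto
  qed
  have "ereal s0 \<le> hausdorff_dim X"
    unfolding hausdorff_dim_def using measure_pos by (intro Inf_greatest) (auto simp: not_less[symmetric])
  then show ?thesis by (simp add: X_def s0_def \<phi>_def)
qed

end
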